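(* Let $d\ge1$, $\epsilon>0$, and let $f(X)=\sum_{I\in\mathcal I}c_IX^I$ be a free power series in $d$ noncommuting variables (with $c_I\in\mathbb C$) which converges for all $\|X\|\le d+\epsilon$. The function $f$ is matrix monotone on the set of $d$-tuples $X$ of self-adjoint matrices with $\|X\|\le\frac1d$ if and only if for each $1\le k\le d$ the infinite matrix $[c_{I^*x_kJ}]_{I,J\in\mathcal I}$ is positive semidefinite.
   Context: $\mathcal I$ is the set of all words (including the empty word) in the letters $x_1,\dots,x_d$; $I^*$ is the word $I$ with its letters reversed; $I^*x_kJ$ denotes concatenation. For a $d$-tuple $X$ of $n\times n$ matrices ($n$ arbitrary), $X^I$ is the corresponding product: $X^e=1$ for the empty word $e$ and $X^{x_kw}=X_kX^w$. $\|X\|=\max_i\|X_i\|$ (operator norm). Convergence of $\sum_Ic_IX^I$ is convergence of the sum over the countable index set $\mathcal I$, for matrix tuples $X$ of every size. For tuples of self-adjoint matrices of the same size, $X\le Y$ means $Y_i-X_i$ is positive semidefinite for all $i$. $f$ is matrix monotone on a set if for all $X,Y$ of the same size in the set, $X\le Y$ implies $f(X)\le f(Y)$ (i.e. $f(Y)-f(X)$ is positive semidefinite). An infinite matrix is positive semidefinite if every finite principal submatrix is positive semidefinite. *)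

theory Defs
  imports
    "HOL-Analysis.Infinite_Sum"
    "Jordan_Normal_Form.Schur_Decomposition"
begin

text \<open>The size of the matrices is quantified inside the statement, so matrices are those of
  \<^theory>\<open>Jordan_Normal_Form.Matrix\<close>. A \<open>d\<close>-tuple of \<open>n \<times> n\<close> matrices is a function on indices,
  of which only the values at \<open>i < d\<close> matter.\<close>

definition mat_tuple :: "nat \<Rightarrow> nat \<Rightarrow> (nat \<Rightarrow> complex mat) \<Rightarrow> bool" where
  "mat_tuple d n X \<longleftrightarrow> (\<forall>i<d. X i \<in> carrier_mat n n)"

definition self_adjoint :: "complex mat \<Rightarrow> bool" where
  "self_adjoint A \<longleftrightarrow> square_mat A \<and> mat_adjoint A = A"

definition euclid_norm :: "complex vec \<Rightarrow> real" where
  "euclid_norm v = sqrt (Re (v \<bullet>c v))"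

definition op_norm :: "complex mat \<Rightarrow> real" where
  "op_norm A = Sup {euclid_norm (A *\<^sub>v v) | v. v \<in> carrier_vec (dim_col A) \<and> euclid_norm v \<le> 1}"

definition tuple_norm :: "nat \<Rightarrow> (nat \<Rightarrow> complex mat) \<Rightarrow> real" where
  "tuple_norm d X = Max ((\<lambda>i. op_norm (X i)) ` {..<d})"

definition psd_mat :: "complex mat \<Rightarrow> bool" where
  "psd_mat A \<longleftrightarrow> self_adjoint A \<and> (\<forall>v \<in> carrier_vec (dim_row A). 0 \<le> Re ((A *\<^sub>v v) \<bullet>c v))"

definition mat_le :: "complex mat \<Rightarrow> complex mat \<Rightarrow> bool" where
  "mat_le A B \<longleftrightarrow> psd_mat (B - A)"

definition tuple_le :: "nat \<Rightarrow> (nat \<Rightarrow> complex mat) \<Rightarrow> (nat \<Rightarrow> complex mat) \<Rightarrow> bool" where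
  "tuple_le d X Y \<longleftrightarrow> (\<forall>i<d. mat_le (X i) (Y i))"

text \<open>The letters \<open>x\<^sub>1, \<dots>, x\<^sub>d\<close> are represented by \<open>0, \<dots>, d - 1\<close>.\<close>

definition words :: "nat \<Rightarrow> nat list set" where
  "words d = lists {..<d}"

primrec word_prod :: "nat \<Rightarrow> (nat \<Rightarrow> complex mat) \<Rightarrow> nat list \<Rightarrow> complex mat" where
  "word_prod n X [] = 1\<^sub>m n"
| "word_prod n X (k # w) = X k * word_prod n X w"

text \<open>Convergence is unordered summation over the countable set of words, in the (unique Hausdorff
  vector space) topology of the finite-dimensional space of \<open>n \<times> n\<close> matrices, that is, entrywise.\<close>

definition series_converges :: "nat \<Rightarrow> (nat list \<Rightarrow> complex) \<Rightarrow> nat \<Rightarrow> (nat \<Rightarrow> complex mat) \<Rightarrow> bool" where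
  "series_converges d c n X \<longleftrightarrow>
     (\<forall>i<n. \<forall>j<n. (\<lambda>I. (c I \<cdot>\<^sub>m word_prod n X I) $$ (i, j)) summable_on words d)"

definition free_series :: "nat \<Rightarrow> (nat list \<Rightarrow> complex) \<Rightarrow> nat \<Rightarrow> (nat \<Rightarrow> complex mat) \<Rightarrow> complex mat" where
  "free_series d c n X =
     mat n n (\<lambda>(i, j). \<Sum>\<^sub>\<infinity>I\<in>words d. (c I \<cdot>\<^sub>m word_prod n X I) $$ (i, j))"

text \<open>A free function \<open>F\<close> and a free set \<open>S\<close> are graded by the size \<open>n\<close> of the matrices.\<close>

definition matrix_monotone_on ::
  "nat \<Rightarrow> (nat \<Rightarrow> (nat \<Rightarrow> complex mat) set) \<Rightarrow> (nat \<Rightarrow> (nat \<Rightarrow> complex mat) \<Rightarrow> complex mat) \<Rightarrow> bool" where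
  "matrix_monotone_on d S F \<longleftrightarrow>
     (\<forall>n. \<forall>X\<in>S n. \<forall>Y\<in>S n. tuple_le d X Y \<longrightarrow> mat_le (F n X) (F n Y))"

definition self_adjoint_ball :: "nat \<Rightarrow> real \<Rightarrow> nat \<Rightarrow> (nat \<Rightarrow> complex mat) set" where
  "self_adjoint_ball d r n =
     {X. mat_tuple d n X \<and> (\<forall>i<d. self_adjoint (X i)) \<and> tuple_norm d X \<le> r}"

text \<open>A finite principal submatrix is given by an enumeration \<open>ws\<close> of a finite set of indices.\<close>

definition infinite_psd :: "'a set \<Rightarrow> ('a \<Rightarrow> 'a \<Rightarrow> complex) \<Rightarrow> bool" where
  "infinite_psd S K \<longleftrightarrow>
     (\<forall>ws. distinct ws \<and> set ws \<subseteq> S \<longrightarrow>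
        psd_mat (mat (length ws) (length ws) (\<lambda>(i, j). K (ws ! i) (ws ! j))))"

end

theory Submission
  imports "HOL-Analysis.Derivative" "HOL-Analysis.L2_Norm" Defs
begin

text \<open>
  Both implications rest on one formula. Convergence at the scalar tuple \<open>(d + \<epsilon>, \<dots>, d + \<epsilon>)\<close> makes the series
  converge absolutely with room to spare, so on tuples of self-adjoint contractions it may be differentiated
  term by term. Along the segment \<open>Z = X + t (Y - X)\<close> each word is differentiated letter by letter, and the
  letters to the left of the marked one are moved to the other side of the inner product, which reverses them:
  the derivative of \<open>\<langle>f(Z) v, v\<rangle>\<close> is the sum over \<open>k\<close>, \<open>I\<close>, \<open>J\<close> of
  \<open>c (rev I @ k # J) * \<langle>(Y\<^sub>k - X\<^sub>k) Z\<^sup>J v, Z\<^sup>I v\<rangle>\<close> (\<open>form_has_derivative\<close>, \<open>derivative_split_sum\<close>).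

  If the coefficient kernels are positive semidefinite and \<open>X \<le> Y\<close>, this derivative is nonnegative, because it
  pairs positive semidefinite kernels with the Gram kernels of positive semidefinite increments
  (\<open>psd_kernel_times_gram_nonneg\<close>, a form of the Schur product theorem). Hence \<open>f(X) \<le> f(Y)\<close>.

  Conversely, if \<open>f\<close> is monotone, then the derivative is nonnegative in every positive direction. In the direction
  \<open>u u\<^sup>*\<close> in the coordinate \<open>k\<close> it is the value of the \<open>k\<close>-th coefficient kernel at the vector of all
  \<open>\<langle>Z\<^sup>J v, u\<rangle>\<close>. So it suffices to realise an arbitrary finitely supported vector in this way, at least
  approximately, by a self-adjoint tuple \<open>Z\<close> of small norm. This is possible on a truncated Fock space: for
  \<open>Z\<^sub>i = s * (creation + annihilation)\<close> and the vacuum \<open>v\<close>, the leading term of \<open>Z\<^sup>J v\<close> is \<open>s ^ length J\<close> times the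
  basis vector of \<open>J\<close>, and a \<open>u\<close> with suitably weighted coordinates isolates it up to an error of order \<open>s\<close>
  that is uniform in \<open>J\<close> (\<open>fock_interpolation\<close>). Letting \<open>s\<close> tend to \<open>0\<close> proves the claim.

  Positivity is expressed throughout by the order on \<open>complex\<close>, in which \<open>0 \<le> z\<close> includes that \<open>z\<close> is real. A
  matrix is positive semidefinite if and only if its quadratic form is nonnegative in this sense
  (\<open>psd_mat_iff_form_nonneg\<close>), so the self-adjointness of \<open>f(Y) - f(X)\<close> needs no separate argument.
\<close>

\<comment> \<open>Inner products and entries are those of vectors of variable dimension.\<close>
unbundle no inner_syntax and no vec_syntax

section \<open>Self-adjoint matrices and positive semidefinite kernels\<close>

lemma self_adjoint_iff_entries:
  assumes "A \<in> carrier_mat n n"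
  shows "self_adjoint A \<longleftrightarrow> (\<forall>i<n. \<forall>j<n. A $$ (i, j) = cnj (A $$ (j, i)))"
proof -
  have adj: "mat_adjoint A = mat n n (\<lambda>(i, j). cnj (A $$ (j, i)))"
    using assms by (intro eq_matI) (auto simp: mat_adjoint_def mat_of_rows_index)
  have "mat_adjoint A = A \<longleftrightarrow> (\<forall>i<n. \<forall>j<n. A $$ (i, j) = cnj (A $$ (j, i)))"
    unfolding adj mat_eq_iff using assms by (auto dest: sym)
  then show ?thesis
    using assms by (simp add: self_adjoint_def)
qed

lemma self_adjoint_entry:
  "A \<in> carrier_mat n n \<Longrightarrow> self_adjoint A \<Longrightarrow> i < n \<Longrightarrow> j < n \<Longrightarrow> A $$ (i, j) = cnj (A $$ (j, i))"
  using self_adjoint_iff_entries by blast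

lemma self_adjointI:
  assumes "A \<in> carrier_mat n n" "\<And>i j. i < n \<Longrightarrow> j < n \<Longrightarrow> A $$ (i, j) = cnj (A $$ (j, i))"
  shows "self_adjoint A"
  unfolding self_adjoint_iff_entries[OF assms(1)] using assms(2) by blast

lemma quadratic_form_eq_sum:
  assumes "A \<in> carrier_mat n n" "v \<in> carrier_vec n" "u \<in> carrier_vec n"
  shows "(A *\<^sub>v v) \<bullet>c u = (\<Sum>i<n. \<Sum>j<n. A $$ (i, j) * v $ j * cnj (u $ i))"
  using assms
  by (auto simp: scalar_prod_def row_def sum_distrib_right atLeast0LessThan intro!: sum.cong)

lemma cscalar_prod_eq_sum:
  assumes "u \<in> carrier_vec n"
  shows "v \<bullet>c u = (\<Sum>i<n. v $ i * cnj (u $ i))"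
  using assms by (auto simp: scalar_prod_def atLeast0LessThan intro!: sum.cong)

lemma cscalar_prod_cnj:
  fixes u v :: "complex vec"
  assumes "v \<in> carrier_vec n" "u \<in> carrier_vec n"
  shows "cnj (v \<bullet>c u) = u \<bullet>c v"
  using assms by (simp add: cscalar_prod_eq_sum mult.commute)

lemma self_adjoint_move:
  assumes A: "A \<in> carrier_mat n n" "self_adjoint A"
    and v: "v \<in> carrier_vec n" "u \<in> carrier_vec n"
  shows "(A *\<^sub>v v) \<bullet>c u = v \<bullet>c (A *\<^sub>v u)"
proof -
  have h: "A $$ (i, j) = cnj (A $$ (j, i))" if "i < n" "j < n" for i j
    using A that by (intro self_adjoint_entry)
  have "v \<bullet>c (A *\<^sub>v u) = cnj ((A *\<^sub>v u) \<bullet>c v)"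
    using A v by (intro cscalar_prod_cnj[symmetric]) auto
  also have "\<dots> = (\<Sum>i<n. \<Sum>j<n. cnj (A $$ (i, j)) * cnj (u $ j) * v $ i)"
    using A v by (simp add: quadratic_form_eq_sum)
  also have "\<dots> = (\<Sum>j<n. \<Sum>i<n. A $$ (j, i) * v $ i * cnj (u $ j))"
    by (subst sum.swap) (intro sum.cong refl, simp flip: h)
  also have "\<dots> = (A *\<^sub>v v) \<bullet>c u"
    using A v by (simp add: quadratic_form_eq_sum)
  finally show ?thesis ..
qed

text \<open>A Hermitian form over a finite index set, with the convention that makes \<open>K i j = b i * cnj (b j)\<close> the
  rank-one example. The order on \<open>complex\<close> says that the form is real and nonnegative, so the Hermitian
  symmetry of the kernel is a consequence and not a second requirement.\<close>

definition psd_kernel :: "'a set \<Rightarrow> ('a \<Rightarrow> 'a \<Rightarrow> complex) \<Rightarrow> bool" where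
  "psd_kernel F K \<longleftrightarrow> (\<forall>a. 0 \<le> (\<Sum>i\<in>F. \<Sum>j\<in>F. K i j * a j * cnj (a i)))"

lemma psd_kernelD:
  "psd_kernel F K \<Longrightarrow> 0 \<le> (\<Sum>i\<in>F. \<Sum>j\<in>F. K i j * a j * cnj (a i))"
  unfolding psd_kernel_def by blast

text \<open>Testing a kernel on vectors supported at two points is what yields both the Hermitian symmetry
  (polarisation) and the vanishing of the row of a zero diagonal entry.\<close>

lemma kernel_form_two_points:
  assumes "finite F" "x \<in> F" "y \<in> F" "x \<noteq> y"
    and a: "\<And>i. i \<noteq> x \<Longrightarrow> i \<noteq> y \<Longrightarrow> a i = 0"
  shows "(\<Sum>i\<in>F. \<Sum>j\<in>F. K i j * a j * cnj (a i)) =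
    K x x * a x * cnj (a x) + K x y * a y * cnj (a x)
    + K y x * a x * cnj (a y) + K y y * a y * cnj (a y)"
proof -
  have 1: "(\<Sum>j\<in>F. g j) = g x + g y" if "\<And>j. j \<noteq> x \<Longrightarrow> j \<noteq> y \<Longrightarrow> g j = 0" for g :: "'a \<Rightarrow> complex"
  proof -
    have "(\<Sum>j\<in>F. g j) = (\<Sum>j\<in>{x, y}. g j)"
      using assms that by (intro sum.mono_neutral_right) auto
    then show ?thesis using assms by simp
  qed
  have "(\<Sum>j\<in>F. K i j * a j * cnj (a i)) = K i x * a x * cnj (a i) + K i y * a y * cnj (a i)" for i
    by (rule 1) (simp add: a)
  then have "(\<Sum>i\<in>F. \<Sum>j\<in>F. K i j * a j * cnj (a i)) =
      (\<Sum>i\<in>F. K i x * a x * cnj (a i) + K i y * a y * cnj (a i))"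
    by simp
  also have "\<dots> = K x x * a x * cnj (a x) + K x y * a y * cnj (a x)
    + (K y x * a x * cnj (a y) + K y y * a y * cnj (a y))"
    by (rule 1) (simp add: a)
  finally show ?thesis
    by (simp add: algebra_simps)
qed

lemma psd_kernel_two_points:
  assumes K: "psd_kernel F K" and F: "finite F" "x \<in> F" "y \<in> F" "x \<noteq> y"
  shows "0 \<le> K x x * a * cnj a + K x y * b * cnj a + K y x * a * cnj b + K y y * b * cnj b"
  using psd_kernelD[OF K, of "\<lambda>i. if i = x then a else if i = y then b else 0"] \<open>x \<noteq> y\<close>
  by (subst (asm) kernel_form_two_points[OF F]) auto

lemma psd_kernel_diag:
  assumes "psd_kernel F K" "finite F" "x \<in> F"
  shows "0 \<le> K x x"
proof -
  have "0 \<le> (\<Sum>i\<in>F. \<Sum>j\<in>F. K i j * of_bool (j = x) * cnj (of_bool (i = x)))"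
    using psd_kernelD[OF assms(1), of "\<lambda>i. of_bool (i = x)"] .
  also have "\<dots> = (\<Sum>i\<in>F. if i = x then (\<Sum>j\<in>F. if j = x then K x x else 0) else 0)"
    by (intro sum.cong) (auto intro!: sum.cong)
  also have "\<dots> = K x x"
    using assms by simp
  finally show ?thesis .
qed

text \<open>Polarisation: the two-point form at \<open>(1, 1)\<close> and \<open>(1, \<i>)\<close> is real, which ties the imaginary and the real
  parts of \<open>K x y\<close> and \<open>K y x\<close>.\<close>

lemma psd_kernel_hermitian:
  assumes K: "psd_kernel F K" and F: "finite F" "x \<in> F" "y \<in> F"
  shows "K x y = cnj (K y x)"
proof (cases "x = y")
  case True
  have "Im (K x x) = 0"
    using psd_kernel_diag[OF K F(1,2)] by (simp add: less_eq_complex_def)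
  with True show ?thesis
    by (simp add: complex_eq_iff)
next
  case False
  note * = psd_kernel_two_points[OF K F False]
  have d: "0 \<le> K x x" "0 \<le> K y y"
    using psd_kernel_diag[OF K F(1)] F by auto
  have "Im (K x y) = - Im (K y x)"
    using *[of 1 1] d by (simp add: less_eq_complex_def)
  moreover have "Re (K x y) = Re (K y x)"
    using *[of 1 \<i>] d by (simp add: less_eq_complex_def)
  ultimately show ?thesis
    by (simp add: complex_eq_iff)
qed

text \<open>A nonzero entry in the row of a zero diagonal entry would make the two-point form affine in the first
  coordinate, hence unbounded below.\<close>

lemma psd_kernel_zero_diag:
  assumes K: "psd_kernel F K" and F: "finite F" "x \<in> F" "y \<in> F" and z: "K x x = 0"
  shows "K x y = 0"
proof (cases "x = y")
  case True
  then show ?thesis using z by simp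
next
  case False
  have h: "K y x = cnj (K x y)" using psd_kernel_hermitian[OF K F(1,3,2)] .
  define q where "q = K x y"
  note * = psd_kernel_two_points[OF K F False]
  show ?thesis
  proof (rule ccontr)
    assume "K x y \<noteq> 0"
    then have m: "(cmod (K x y))\<^sup>2 > 0" by simp
    define D where "D = Re (K y y)"
    \<comment> \<open>Chosen so that the form takes the value \<open>-1\<close>.\<close>
    define r where "r = (D + 1) / (cmod (K x y))\<^sup>2"
    have "0 \<le> Re (K x y * (-1) * cnj (of_real (r/2) * K x y) + K y x * (of_real (r/2) * K x y) * (-1) + K y y)"
      using *[of "of_real (r/2) * K x y" "-1"] z by (simp add: less_eq_complex_def)
    also have "\<dots> = - r * (cmod (K x y))\<^sup>2 + D"
      unfolding h D_def cmod_power2 by (simp add: algebra_simps power2_eq_square)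
    also have "\<dots> = -1" using m unfolding r_def by simp
    finally show False by simp
  qed
qed

lemma psd_kernel_subset:
  assumes K: "psd_kernel F K" and F: "finite F" "G \<subseteq> F"
  shows "psd_kernel G K"
  unfolding psd_kernel_def
proof
  fix a
  have "0 \<le> (\<Sum>i\<in>F. \<Sum>j\<in>F. K i j * (if j \<in> G then a j else 0) * cnj (if i \<in> G then a i else 0))"
    using psd_kernelD[OF K, of "\<lambda>i. if i \<in> G then a i else 0"] .
  also have "\<dots> = (\<Sum>i\<in>G. \<Sum>j\<in>F. K i j * (if j \<in> G then a j else 0) * cnj (if i \<in> G then a i else 0))"
    using F by (intro sum.mono_neutral_right) auto
  also have "\<dots> = (\<Sum>i\<in>G. \<Sum>j\<in>G. K i j * (if j \<in> G then a j else 0) * cnj (if i \<in> G then a i else 0))"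
    using F by (intro sum.cong[OF refl] sum.mono_neutral_right) auto
  also have "\<dots> = (\<Sum>i\<in>G. \<Sum>j\<in>G. K i j * a j * cnj (a i))"
    by (intro sum.cong) auto
  finally show "0 \<le> (\<Sum>i\<in>G. \<Sum>j\<in>G. K i j * a j * cnj (a i))" .
qed

text \<open>Cholesky decomposition by induction on the index set: completing the square in the variable of the new
  index \<open>x\<close> splits off one rank-one kernel, and what is left is again positive semidefinite and vanishes in
  the row and the column of \<open>x\<close>.\<close>

lemma psd_kernel_factorization:
  assumes "finite F" "psd_kernel F K"
  shows "\<exists>B. \<forall>i\<in>F. \<forall>j\<in>F. K i j = (\<Sum>b\<leftarrow>B. b i * cnj (b j))"
  using assms
proof (induction F arbitrary: K rule: finite_induct)
  case empty
  then show ?case by simp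
next
  case (insert x F)
  note K = insert.prems
  let ?F = "insert x F"
  have fin: "finite ?F" using insert.hyps by simp
  have herm: "K j x = cnj (K x j)" if "j \<in> ?F" for j
    using psd_kernel_hermitian[OF K fin that] by simp
  have ext: "\<exists>B. (\<forall>i\<in>F. \<forall>j\<in>F. G i j = (\<Sum>b\<leftarrow>B. b i * cnj (b j))) \<and> (\<forall>b\<in>set B. b x = 0)"
    if G: "psd_kernel F G" for G
  proof -
    obtain B where B: "\<forall>i\<in>F. \<forall>j\<in>F. G i j = (\<Sum>b\<leftarrow>B. b i * cnj (b j))"
      using insert.IH[OF G] by blast
    have "(\<Sum>b\<leftarrow>map (\<lambda>b. b(x := 0)) B. b i * cnj (b j)) = (\<Sum>b\<leftarrow>B. b i * cnj (b j))"
      if "i \<in> F" "j \<in> F" for i j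
      using that insert.hyps by (auto simp: o_def intro!: arg_cong[of _ _ sum_list] map_cong)
    with B show ?thesis
      by (intro exI[of _ "map (\<lambda>b. b(x := 0)) B"]) auto
  qed
  have d: "0 \<le> K x x" using psd_kernel_diag[OF K fin] by simp
  show ?case
  proof (cases "K x x = 0")
    case True
    have z: "K x j = 0" "K j x = 0" if "j \<in> ?F" for j
      using psd_kernel_zero_diag[OF K fin _ that True] herm[OF that] by auto
    obtain B where B: "\<forall>i\<in>F. \<forall>j\<in>F. K i j = (\<Sum>b\<leftarrow>B. b i * cnj (b j))" "\<forall>b\<in>set B. b x = 0"
      using ext[OF psd_kernel_subset[OF K fin]] by blast
    have "(\<Sum>b\<leftarrow>B. b x * cnj (b j)) = 0" "(\<Sum>b\<leftarrow>B. b j * cnj (b x)) = 0" for j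
      using B(2) by (induction B) auto
    then show ?thesis
      using B z by (intro exI[of _ B]) auto
  next
    case False
    define p where "p = Re (K x x)"
    have p: "p > 0" "K x x = of_real p"
      using d False by (auto simp: p_def less_eq_complex_def complex_eq_iff)
    define b0 where "b0 = (\<lambda>i. K i x / of_real (sqrt p))"
    define G where "G = (\<lambda>i j. K i j - b0 i * cnj (b0 j))"
    have sq: "complex_of_real (sqrt p) * complex_of_real (sqrt p) = of_real p"
      using p by (simp flip: of_real_mult)
    have b0: "b0 i * cnj (b0 j) = K i x * K x j / of_real p" if "j \<in> ?F" for i j
      using herm[OF that] sq by (simp add: b0_def)
    have "psd_kernel F G"
      unfolding psd_kernel_def
    proof
      fix a
      define s where "s = (\<Sum>j\<in>F. K x j * a j)"
      \<comment> \<open>The value at \<open>x\<close> that minimises the form for the given values on \<open>F\<close>.\<close>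
      define a' where "a' = a(x := - s / of_real p)"
      have a': "a' j = a j" if "j \<in> F" for j
        using that insert.hyps by (auto simp: a'_def)
      have a'x: "a' x = - s / of_real p" by (simp add: a'_def)
      have cs: "(\<Sum>i\<in>F. K i x * cnj (a i)) = cnj s"
        by (simp add: s_def herm)
      have "0 \<le> (\<Sum>i\<in>?F. \<Sum>j\<in>?F. K i j * a' j * cnj (a' i))"
        using psd_kernelD[OF K] .
      also have "\<dots> = K x x * a' x * cnj (a' x) + (\<Sum>j\<in>F. K x j * a j) * cnj (a' x)
          + a' x * (\<Sum>i\<in>F. K i x * cnj (a i)) + (\<Sum>i\<in>F. \<Sum>j\<in>F. K i j * a j * cnj (a i))"
        using insert.hyps
        by (simp add: sum.distrib sum_distrib_left sum_distrib_right a' algebra_simps)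
      also have "\<dots> = (\<Sum>i\<in>F. \<Sum>j\<in>F. K i j * a j * cnj (a i)) - cnj s * s / of_real p"
        unfolding cs s_def[symmetric] a'x p(2) using p(1) by (simp add: field_simps)
      also have "cnj s * s / of_real p = (\<Sum>i\<in>F. \<Sum>j\<in>F. K i x * K x j / of_real p * a j * cnj (a i))"
        unfolding cs[symmetric] unfolding s_def sum_product
        by (simp add: sum_divide_distrib algebra_simps)
      also have "(\<Sum>i\<in>F. \<Sum>j\<in>F. K i j * a j * cnj (a i)) - \<dots> = (\<Sum>i\<in>F. \<Sum>j\<in>F. G i j * a j * cnj (a i))"
        by (simp add: G_def b0 algebra_simps flip: sum_subtractf)
      finally show "0 \<le> (\<Sum>i\<in>F. \<Sum>j\<in>F. G i j * a j * cnj (a i))" .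
    qed
    then obtain B where B: "\<forall>i\<in>F. \<forall>j\<in>F. G i j = (\<Sum>b\<leftarrow>B. b i * cnj (b j))" "\<forall>b\<in>set B. b x = 0"
      using ext by blast
    have z: "(\<Sum>b\<leftarrow>B. b x * cnj (b j)) = 0" "(\<Sum>b\<leftarrow>B. b j * cnj (b x)) = 0" for j
      using B(2) by (induction B) auto
    have Gx: "G x j = 0" "G j x = 0" if "j \<in> ?F" for j
      using p that by (auto simp: G_def b0)
    have "G i j = (\<Sum>b\<leftarrow>B. b i * cnj (b j))" if "i \<in> ?F" "j \<in> ?F" for i j
      using that B(1) z Gx by (cases "i = x"; cases "j = x") auto
    then show ?thesis
      by (intro exI[of _ "b0 # B"]) (auto simp: G_def algebra_simps)
  qed
qed

lemma psd_mat_iff_psd_kernel: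
  assumes A: "A \<in> carrier_mat n n"
  shows "psd_mat A \<longleftrightarrow> psd_kernel {..<n} (\<lambda>i j. A $$ (i, j))"
proof
  assume p: "psd_mat A"
  show "psd_kernel {..<n} (\<lambda>i j. A $$ (i, j))"
    unfolding psd_kernel_def
  proof
    fix a :: "nat \<Rightarrow> complex"
    let ?v = "vec n a"
    have "0 \<le> Re ((A *\<^sub>v ?v) \<bullet>c ?v)"
      using p A unfolding psd_mat_def by auto
    moreover have "(A *\<^sub>v ?v) \<bullet>c ?v = cnj ((A *\<^sub>v ?v) \<bullet>c ?v)"
      using p A self_adjoint_move[of A n ?v ?v] cscalar_prod_cnj[of "A *\<^sub>v ?v" n ?v]
      unfolding psd_mat_def by auto
    moreover have "(A *\<^sub>v ?v) \<bullet>c ?v = (\<Sum>i<n. \<Sum>j<n. A $$ (i, j) * a j * cnj (a i))"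
      using A by (simp add: quadratic_form_eq_sum)
    moreover have "0 \<le> z" if "0 \<le> Re z" "z = cnj z" for z
      using that by (simp add: less_eq_complex_def complex_eq_iff)
    ultimately show "0 \<le> (\<Sum>i<n. \<Sum>j<n. A $$ (i, j) * a j * cnj (a i))"
      by metis
  qed
next
  assume p: "psd_kernel {..<n} (\<lambda>i j. A $$ (i, j))"
  have "self_adjoint A"
    unfolding self_adjoint_iff_entries[OF A]
    by (intro allI impI psd_kernel_hermitian[OF p]) auto
  moreover have "0 \<le> Re ((A *\<^sub>v v) \<bullet>c v)" if "v \<in> carrier_vec n" for v
    using p that A unfolding psd_kernel_def
    by (simp add: quadratic_form_eq_sum less_eq_complex_def)
  ultimately show "psd_mat A"
    using A unfolding psd_mat_def by auto
qed

lemma psd_mat_iff_form_nonneg: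
  fixes A :: "complex mat"
  assumes A: "A \<in> carrier_mat n n"
  shows "psd_mat A \<longleftrightarrow> (\<forall>v \<in> carrier_vec n. 0 \<le> (A *\<^sub>v v) \<bullet>c v)"
proof -
  have "psd_kernel {..<n} (\<lambda>i j. A $$ (i, j))" if "\<forall>v \<in> carrier_vec n. 0 \<le> (A *\<^sub>v v) \<bullet>c v"
    unfolding psd_kernel_def
  proof
    fix a
    have "(A *\<^sub>v vec n a) \<bullet>c vec n a = (\<Sum>i<n. \<Sum>j<n. A $$ (i, j) * a j * cnj (a i))"
      using A by (simp add: quadratic_form_eq_sum)
    then show "0 \<le> (\<Sum>i<n. \<Sum>j<n. A $$ (i, j) * a j * cnj (a i))"
      using that by (metis vec_carrier[where ?'a = complex])
  qed
  moreover have "0 \<le> (A *\<^sub>v v) \<bullet>c v" if "psd_kernel {..<n} (\<lambda>i j. A $$ (i, j))" "v \<in> carrier_vec n" for v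
    using that A unfolding psd_kernel_def by (simp add: quadratic_form_eq_sum)
  ultimately show ?thesis
    unfolding psd_mat_iff_psd_kernel[OF A] by blast
qed

text \<open>Frees the definition from enumerations of the finite index sets.\<close>

lemma infinite_psd_iff:
  "infinite_psd S K \<longleftrightarrow> (\<forall>F. finite F \<and> F \<subseteq> S \<longrightarrow> psd_kernel F K)"
proof -
  have sum_ws: "(\<Sum>i<length ws. g (ws ! i)) = (\<Sum>x\<in>set ws. g x)" if "distinct ws" for ws and g :: "'a \<Rightarrow> complex"
    using that by (intro sum.reindex_bij_betw bij_betw_nth) auto
  have *: "psd_mat (mat (length ws) (length ws) (\<lambda>(i, j). K (ws ! i) (ws ! j))) \<longleftrightarrow> psd_kernel (set ws) K"
    (is "psd_mat ?M \<longleftrightarrow> _") if ws: "distinct ws" for ws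
  proof -
    have eq: "(\<Sum>i<length ws. \<Sum>j<length ws. K (ws ! i) (ws ! j) * a (ws ! j) * cnj (a (ws ! i)))
        = (\<Sum>x\<in>set ws. \<Sum>y\<in>set ws. K x y * a y * cnj (a x))" for a
      using sum_ws[OF ws, of "\<lambda>x. \<Sum>y\<in>set ws. K x y * a y * cnj (a x)"]
        sum_ws[OF ws, of "\<lambda>y. K x y * a y * cnj (a x)" for x] by simp
    have "psd_mat ?M \<longleftrightarrow> psd_kernel {..<length ws} (\<lambda>i j. K (ws ! i) (ws ! j))"
      by (subst psd_mat_iff_psd_kernel[of _ "length ws"]) (auto simp: psd_kernel_def)
    also have "\<dots> \<longleftrightarrow> psd_kernel (set ws) K"
    proof
      assume l: "psd_kernel {..<length ws} (\<lambda>i j. K (ws ! i) (ws ! j))"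
      show "psd_kernel (set ws) K"
        unfolding psd_kernel_def eq[symmetric]
        using psd_kernelD[OF l, of "\<lambda>i. a (ws ! i)" for a] by blast
    next
      assume r: "psd_kernel (set ws) K"
      show "psd_kernel {..<length ws} (\<lambda>i j. K (ws ! i) (ws ! j))"
        unfolding psd_kernel_def
      proof
        fix a :: "nat \<Rightarrow> complex"
        define a' where "a' = (\<lambda>x. a (the_inv_into {..<length ws} (\<lambda>i. ws ! i) x))"
        have "a' (ws ! i) = a i" if "i < length ws" for i
          using that ws by (simp add: a'_def the_inv_into_f_f inj_on_nth)
        then have "(\<Sum>i<length ws. \<Sum>j<length ws. K (ws ! i) (ws ! j) * a j * cnj (a i))
            = (\<Sum>x\<in>set ws. \<Sum>y\<in>set ws. K x y * a' y * cnj (a' x))"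
          unfolding eq[symmetric] by simp
        also have "0 \<le> \<dots>"
          using psd_kernelD[OF r] .
        finally show "0 \<le> (\<Sum>i<length ws. \<Sum>j<length ws. K (ws ! i) (ws ! j) * a j * cnj (a i))" .
      qed
    qed
    finally show ?thesis .
  qed
  show ?thesis
    unfolding infinite_psd_def using * finite_distinct_list
    by (metis (no_types, lifting) List.finite_set)
qed

text \<open>The Schur product theorem for \<open>K\<close> and the Gram kernel \<open>\<langle>H y\<^sub>j, y\<^sub>i\<rangle>\<close>. Factoring \<open>H\<close> into rank-one pieces turns the
  sum into a sum of values of the form of \<open>K\<close> itself, so that no positivity of an entrywise product has to be
  established.\<close>

lemma psd_kernel_times_gram_nonneg:
  assumes F: "finite F" and K: "psd_kernel F K"
    and H: "H \<in> carrier_mat n n" "psd_mat H"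
    and y: "\<And>i. i \<in> F \<Longrightarrow> y i \<in> carrier_vec n"
  shows "0 \<le> (\<Sum>i\<in>F. \<Sum>j\<in>F. K i j * ((H *\<^sub>v y j) \<bullet>c y i))"
proof -
  obtain B where B: "\<forall>p\<in>{..<n}. \<forall>q\<in>{..<n}. H $$ (p, q) = (\<Sum>b\<leftarrow>B. b p * cnj (b q))"
    using psd_kernel_factorization H psd_mat_iff_psd_kernel by blast
  define \<beta> where "\<beta> = (\<lambda>b i. \<Sum>q<n. cnj (b q) * y i $ q)"
  have gram: "(H *\<^sub>v y j) \<bullet>c y i = (\<Sum>b\<leftarrow>B. \<beta> b j * cnj (\<beta> b i))" if "i \<in> F" "j \<in> F" for i j
  proof -
    have "(H *\<^sub>v y j) \<bullet>c y i = (\<Sum>p<n. \<Sum>q<n. (\<Sum>b\<leftarrow>B. b p * cnj (b q)) * y j $ q * cnj (y i $ p))"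
      using H y that B by (simp add: quadratic_form_eq_sum)
    also have "\<dots> = (\<Sum>b\<leftarrow>B. \<beta> b j * cnj (\<beta> b i))"
      by (induction B)
        (auto simp: \<beta>_def sum_product sum.distrib algebra_simps intro!: sum.swap[THEN trans] sum.cong)
    finally show ?thesis .
  qed
  have "(\<Sum>i\<in>F. \<Sum>j\<in>F. K i j * ((H *\<^sub>v y j) \<bullet>c y i)) =
      (\<Sum>i\<in>F. \<Sum>j\<in>F. K i j * (\<Sum>b\<leftarrow>B. \<beta> b j * cnj (\<beta> b i)))"
    by (intro sum.cong refl) (simp add: gram)
  also have "\<dots> = (\<Sum>b\<leftarrow>B. \<Sum>i\<in>F. \<Sum>j\<in>F. K i j * \<beta> b j * cnj (\<beta> b i))"
    by (induction B) (simp_all add: algebra_simps sum.distrib)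
  also have "0 \<le> \<dots>"
    using K by (intro sum_list_nonneg) (auto simp: psd_kernel_def)
  finally show ?thesis .
qed

section \<open>Operator norms and words of matrices\<close>

lemma euclid_norm_L2_set:
  assumes "v \<in> carrier_vec n"
  shows "euclid_norm v = L2_set (\<lambda>i. cmod (v $ i)) {..<n}"
  using assms
  by (simp add: euclid_norm_def L2_set_def cscalar_prod_eq_sum cmod_power2 flip: power2_eq_square)

lemma euclid_norm_nonneg [simp]: "0 \<le> euclid_norm v"
  unfolding euclid_norm_L2_set[OF carrier_vecI[OF refl]] by simp

lemma euclid_norm_zero [simp]: "euclid_norm (0\<^sub>v n) = 0"
  by (simp add: euclid_norm_L2_set[of _ n] L2_set_eq_0_iff)

lemma euclid_norm_eq_zero_iff: "v \<in> carrier_vec n \<Longrightarrow> euclid_norm v = 0 \<longleftrightarrow> v = 0\<^sub>v n"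
  by (auto simp: euclid_norm_L2_set[of v n] L2_set_eq_0_iff intro!: eq_vecI)

lemma euclid_norm_smult:
  assumes "v \<in> carrier_vec n"
  shows "euclid_norm (a \<cdot>\<^sub>v v) = cmod a * euclid_norm v"
proof -
  have "euclid_norm (a \<cdot>\<^sub>v v) = L2_set (\<lambda>i. cmod a * cmod (v $ i)) {..<n}"
    using assms by (subst euclid_norm_L2_set[of _ n]) (auto intro!: L2_set_cong simp: norm_mult)
  then show ?thesis
    using assms by (simp add: euclid_norm_L2_set L2_set_right_distrib)
qed

lemma euclid_norm_triangle:
  assumes "u \<in> carrier_vec n" "v \<in> carrier_vec n"
  shows "euclid_norm (u + v) \<le> euclid_norm u + euclid_norm v"
proof -
  have "euclid_norm (u + v) \<le> L2_set (\<lambda>i. cmod (u $ i) + cmod (v $ i)) {..<n}"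
    using assms by (subst euclid_norm_L2_set[of _ n]) (auto intro!: L2_set_mono simp: norm_triangle_ineq)
  also have "\<dots> \<le> euclid_norm u + euclid_norm v"
    using assms by (simp add: euclid_norm_L2_set L2_set_triangle_ineq)
  finally show ?thesis .
qed

lemma cscalar_prod_norm_le:
  assumes "u \<in> carrier_vec n" "v \<in> carrier_vec n"
  shows "cmod (v \<bullet>c u) \<le> euclid_norm v * euclid_norm u"
proof -
  have "cmod (v \<bullet>c u) \<le> (\<Sum>i<n. \<bar>cmod (v $ i)\<bar> * \<bar>cmod (u $ i)\<bar>)"
    using assms by (simp add: cscalar_prod_eq_sum) (rule order_trans[OF norm_sum], simp add: norm_mult)
  also have "\<dots> \<le> euclid_norm v * euclid_norm u"
    using assms by (simp only: euclid_norm_L2_set[of _ n] L2_set_mult_ineq)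
  finally show ?thesis .
qed

text \<open>Equivalent to \<open>op_norm A \<le> r\<close> for \<open>0 \<le> r\<close>, but without a supremum, which makes it stable under sums and
  scalings by direct estimates.\<close>

definition norm_bounded :: "nat \<Rightarrow> complex mat \<Rightarrow> real \<Rightarrow> bool" where
  "norm_bounded n A r \<longleftrightarrow> (\<forall>v\<in>carrier_vec n. euclid_norm (A *\<^sub>v v) \<le> r * euclid_norm v)"

lemma norm_boundedD:
  "norm_bounded n A r \<Longrightarrow> v \<in> carrier_vec n \<Longrightarrow> euclid_norm (A *\<^sub>v v) \<le> r * euclid_norm v"
  by (simp add: norm_bounded_def)

lemma norm_bounded_mono: 
  assumes "norm_bounded n A r" "r \<le> s"
  shows "norm_bounded n A s"
  unfolding norm_bounded_def
proof
  fix v :: "complex vec" assume v: "v \<in> carrier_vec n"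
  have "r * euclid_norm v \<le> s * euclid_norm v"
    using assms v by (intro mult_right_mono) auto
  with norm_boundedD[OF assms(1) v] show "euclid_norm (A *\<^sub>v v) \<le> s * euclid_norm v"
    by linarith
qed

lemma norm_bounded_add:
  assumes "A \<in> carrier_mat n n" "B \<in> carrier_mat n n" "norm_bounded n A r" "norm_bounded n B s"
  shows "norm_bounded n (A + B) (r + s)"
  unfolding norm_bounded_def
proof
  fix v :: "complex vec" assume v: "v \<in> carrier_vec n"
  have "euclid_norm ((A + B) *\<^sub>v v) \<le> euclid_norm (A *\<^sub>v v) + euclid_norm (B *\<^sub>v v)"
    using assms v by (simp add: add_mult_distrib_mat_vec euclid_norm_triangle[of _ n])
  then show "euclid_norm ((A + B) *\<^sub>v v) \<le> (r + s) * euclid_norm v"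
    using norm_boundedD[OF assms(3) v] norm_boundedD[OF assms(4) v] by (simp add: algebra_simps)
qed

lemma smult_mult_mat_vec:
  fixes A :: "complex mat"
  assumes "A \<in> carrier_mat n m" "v \<in> carrier_vec m"
  shows "(a \<cdot>\<^sub>m A) *\<^sub>v v = a \<cdot>\<^sub>v (A *\<^sub>v v)"
  using assms by (intro eq_vecI) auto

lemma norm_bounded_smult:
  assumes "A \<in> carrier_mat n n" "norm_bounded n A r"
  shows "norm_bounded n (a \<cdot>\<^sub>m A) (cmod a * r)"
  using assms
  by (auto simp: norm_bounded_def smult_mult_mat_vec[of A n n] euclid_norm_smult[of _ n] mult.assoc
      intro!: mult_left_mono)

text \<open>A crude bound; it shows that the supremum in the operator norm is taken over a bounded set.\<close>

lemma norm_bounded_entry_sum: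
  assumes A: "A \<in> carrier_mat n n"
  shows "norm_bounded n A (\<Sum>i<n. \<Sum>j<n. cmod (A $$ (i, j)))"
  unfolding norm_bounded_def
proof
  fix v :: "complex vec" assume v: "v \<in> carrier_vec n"
  have c: "cmod (v $ j) \<le> euclid_norm v" if "j < n" for j
    using that v by (simp add: euclid_norm_L2_set) (rule member_le_L2_set[where f="\<lambda>i. cmod (v $ i)"], auto)
  have "euclid_norm (A *\<^sub>v v) \<le> (\<Sum>i<n. cmod ((A *\<^sub>v v) $ i))"
    using A v by (subst euclid_norm_L2_set[of _ n]) (simp, rule L2_set_le_sum, simp)
  also have "\<dots> \<le> (\<Sum>i<n. \<Sum>j<n. cmod (A $$ (i, j)) * euclid_norm v)"
  proof (rule sum_mono)
    fix i assume i: "i \<in> {..<n}"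
    have "(A *\<^sub>v v) $ i = (\<Sum>j<n. A $$ (i, j) * v $ j)"
      using A v i by (auto simp: scalar_prod_def row_def atLeast0LessThan intro!: sum.cong)
    then have "cmod ((A *\<^sub>v v) $ i) \<le> (\<Sum>j<n. cmod (A $$ (i, j)) * cmod (v $ j))"
      using norm_sum[of "\<lambda>j. A $$ (i, j) * v $ j" "{..<n}"] by (simp add: norm_mult)
    also have "\<dots> \<le> (\<Sum>j<n. cmod (A $$ (i, j)) * euclid_norm v)"
      by (intro sum_mono mult_left_mono c) auto
    finally show "cmod ((A *\<^sub>v v) $ i) \<le> (\<Sum>j<n. cmod (A $$ (i, j)) * euclid_norm v)" .
  qed
  also have "\<dots> = (\<Sum>i<n. \<Sum>j<n. cmod (A $$ (i, j))) * euclid_norm v"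
    by (simp add: sum_distrib_right)
  finally show "euclid_norm (A *\<^sub>v v) \<le> (\<Sum>i<n. \<Sum>j<n. cmod (A $$ (i, j))) * euclid_norm v" .
qed

lemma op_norm_le:
  assumes A: "A \<in> carrier_mat n n" and r: "norm_bounded n A r" "0 \<le> r"
  shows "op_norm A \<le> r"
  unfolding op_norm_def
proof (rule cSup_least)
  have "euclid_norm (A *\<^sub>v 0\<^sub>v n) \<in> {euclid_norm (A *\<^sub>v v) |v. v \<in> carrier_vec (dim_col A) \<and> euclid_norm v \<le> 1}"
    using A by (intro CollectI exI[of _ "0\<^sub>v n"]) auto
  then show "{euclid_norm (A *\<^sub>v v) |v. v \<in> carrier_vec (dim_col A) \<and> euclid_norm v \<le> 1} \<noteq> {}"
    by blast
next
  fix x assume "x \<in> {euclid_norm (A *\<^sub>v v) |v. v \<in> carrier_vec (dim_col A) \<and> euclid_norm v \<le> 1}"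
  then obtain v where v: "v \<in> carrier_vec n" "euclid_norm v \<le> 1" "x = euclid_norm (A *\<^sub>v v)"
    using A by auto
  have "r * euclid_norm v \<le> r * 1"
    using v r by (intro mult_left_mono) auto
  then show "x \<le> r"
    using norm_boundedD[OF r(1) v(1)] v(3) by simp
qed

lemma norm_bounded_op_norm:
  assumes A: "A \<in> carrier_mat n n"
  shows "norm_bounded n A (op_norm A)"
  unfolding norm_bounded_def
proof
  fix v :: "complex vec" assume v: "v \<in> carrier_vec n"
  let ?S = "{euclid_norm (A *\<^sub>v v) |v. v \<in> carrier_vec (dim_col A) \<and> euclid_norm v \<le> 1}"
  define C where "C = (\<Sum>i<n. \<Sum>j<n. cmod (A $$ (i, j)))"
  have bdd: "bdd_above ?S"
  proof (rule bdd_aboveI)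
    fix x assume "x \<in> ?S"
    then obtain v where v: "v \<in> carrier_vec n" "euclid_norm v \<le> 1" "x = euclid_norm (A *\<^sub>v v)"
      using A by auto
    have "C * euclid_norm v \<le> C * 1"
      using v by (intro mult_left_mono) (auto simp: C_def intro!: sum_nonneg)
    then show "x \<le> C"
      using norm_boundedD[OF norm_bounded_entry_sum[OF A] v(1)] v(3) by (simp add: C_def)
  qed
  show "euclid_norm (A *\<^sub>v v) \<le> op_norm A * euclid_norm v"
  proof (cases "v = 0\<^sub>v n")
    case True
    have "A *\<^sub>v 0\<^sub>v n = 0\<^sub>v n" using A by (intro eq_vecI) auto
    then show ?thesis using True by simp
  next
    case False
    define e where "e = euclid_norm v"
    have e: "e > 0"
      using False v euclid_norm_eq_zero_iff[OF v] euclid_norm_nonneg[of v] unfolding e_def by linarith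
    define w where "w = complex_of_real (1 / e) \<cdot>\<^sub>v v"
    have w: "w \<in> carrier_vec n" "euclid_norm w = 1"
      using v e by (auto simp: w_def euclid_norm_smult[of _ n] norm_divide) (simp add: e_def)
    have "euclid_norm (A *\<^sub>v w) \<le> op_norm A"
      unfolding op_norm_def using A w by (intro cSup_upper[OF _ bdd]) auto
    moreover have "A *\<^sub>v w = complex_of_real (1 / e) \<cdot>\<^sub>v (A *\<^sub>v v)"
      using A v by (simp add: w_def mult_mat_vec)
    then have "euclid_norm (A *\<^sub>v w) = euclid_norm (A *\<^sub>v v) / e"
      using A v e euclid_norm_smult[of "A *\<^sub>v v" n "complex_of_real (1 / e)"] by (simp add: norm_divide)
    ultimately show ?thesis
      using e by (simp add: field_simps e_def)
  qed
qed

lemma tuple_norm_le_iff: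
  "1 \<le> d \<Longrightarrow> tuple_norm d X \<le> r \<longleftrightarrow> (\<forall>i<d. op_norm (X i) \<le> r)"
  by (auto simp: tuple_norm_def Max_le_iff lessThan_empty_iff)

lemma words_Cons [simp]: "k # w \<in> words d \<longleftrightarrow> k < d \<and> w \<in> words d"
  and words_Nil [simp]: "[] \<in> words d"
  and words_append [simp]: "v @ w \<in> words d \<longleftrightarrow> v \<in> words d \<and> w \<in> words d"
  and words_rev [simp]: "rev w \<in> words d \<longleftrightarrow> w \<in> words d"
  by (auto simp: words_def)

lemma words_take: "w \<in> words d \<Longrightarrow> take i w \<in> words d"
  and words_drop: "w \<in> words d \<Longrightarrow> drop i w \<in> words d"
  by (auto simp: words_def dest: in_set_takeD in_set_dropD)

lemma words_nth: "w \<in> words d \<Longrightarrow> i < length w \<Longrightarrow> w ! i < d"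
  by (auto simp: words_def)

lemma word_prod_carrier:
  "mat_tuple d n X \<Longrightarrow> w \<in> words d \<Longrightarrow> word_prod n X w \<in> carrier_mat n n"
  by (induction w) (auto simp: mat_tuple_def)

definition word_act :: "nat \<Rightarrow> (nat \<Rightarrow> complex mat) \<Rightarrow> nat list \<Rightarrow> complex vec \<Rightarrow> complex vec" where
  "word_act n X w v = word_prod n X w *\<^sub>v v"

lemma word_act_carrier [simp]:
  "mat_tuple d n X \<Longrightarrow> w \<in> words d \<Longrightarrow> v \<in> carrier_vec n \<Longrightarrow> word_act n X w v \<in> carrier_vec n"
  unfolding word_act_def by (rule mult_mat_vec_carrier[OF word_prod_carrier])

lemma word_act_Nil [simp]: "v \<in> carrier_vec n \<Longrightarrow> word_act n X [] v = v"
  by (simp add: word_act_def)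

lemma word_act_Cons:
  assumes "mat_tuple d n X" "k < d" "w \<in> words d" "v \<in> carrier_vec n"
  shows "word_act n X (k # w) v = X k *\<^sub>v word_act n X w v"
  using assms word_prod_carrier[of d n X w]
  by (auto simp: word_act_def mat_tuple_def intro!: assoc_mult_mat_vec)

lemma word_act_append:
  assumes "mat_tuple d n X" "w \<in> words d" "w' \<in> words d" "v \<in> carrier_vec n"
  shows "word_act n X (w @ w') v = word_act n X w (word_act n X w' v)"
  using assms by (induction w) (auto simp: word_act_Cons)

lemma word_act_norm_le:
  assumes X: "mat_tuple d n X" "\<And>i. i < d \<Longrightarrow> norm_bounded n (X i) r" and r: "0 \<le> r"
    and w: "w \<in> words d" "v \<in> carrier_vec n"
  shows "euclid_norm (word_act n X w v) \<le> r ^ length w * euclid_norm v"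
  using w
proof (induction w)
  case Nil
  then show ?case by simp
next
  case (Cons k w)
  then have w: "k < d" "w \<in> words d" by auto
  have "euclid_norm (X k *\<^sub>v word_act n X w v) \<le> r * euclid_norm (word_act n X w v)"
    using X w Cons.prems by (intro norm_boundedD) auto
  also have "\<dots> \<le> r * (r ^ length w * euclid_norm v)"
    using r Cons w by (intro mult_left_mono) auto
  finally show ?case
    using X w Cons.prems by (simp add: word_act_Cons mult.assoc)
qed

section \<open>Words along a segment of self-adjoint tuples\<close>

lemma self_adjoint_add:
  assumes "A \<in> carrier_mat n n" "B \<in> carrier_mat n n" "self_adjoint A" "self_adjoint B"
  shows "self_adjoint (A + B)"
proof -
  have "(A + B) $$ (i, j) = cnj ((A + B) $$ (j, i))" if "i < n" "j < n" for i j
    using assms that self_adjoint_entry[of A n i j] self_adjoint_entry[of B n i j] by simp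
  then show ?thesis
    by (rule self_adjointI[rotated]) (use assms in \<open>auto intro: add_carrier_mat smult_carrier_mat\<close>)
qed

lemma self_adjoint_smult:
  assumes "A \<in> carrier_mat n n" "self_adjoint A"
  shows "self_adjoint (complex_of_real t \<cdot>\<^sub>m A)"
proof -
  have "(complex_of_real t \<cdot>\<^sub>m A) $$ (i, j) = cnj ((complex_of_real t \<cdot>\<^sub>m A) $$ (j, i))"
    if "i < n" "j < n" for i j
    using assms that self_adjoint_entry[of A n i j] by simp
  then show ?thesis
    by (rule self_adjointI[rotated]) (use assms in \<open>auto intro: add_carrier_mat smult_carrier_mat\<close>)
qed

lemma self_adjoint_minus:
  assumes "A \<in> carrier_mat n n" "B \<in> carrier_mat n n" "self_adjoint A" "self_adjoint B"
  shows "self_adjoint (A - B)"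
proof -
  have "A - B = A + complex_of_real (-1) \<cdot>\<^sub>m B"
    using assms by (intro eq_matI) auto
  then show ?thesis
    using assms by (simp only: self_adjoint_add self_adjoint_smult smult_carrier_mat)
qed

lemma cscalar_prod_add_left:
  fixes x y z :: "complex vec"
  assumes "x \<in> carrier_vec n" "y \<in> carrier_vec n" "z \<in> carrier_vec n"
  shows "(x + a \<cdot>\<^sub>v y) \<bullet>c z = x \<bullet>c z + a * (y \<bullet>c z)"
  using assms by (simp add: add_scalar_prod_distrib[of _ n])

lemma cscalar_prod_add_right:
  assumes "x \<in> carrier_vec n" "y \<in> carrier_vec n" "z \<in> carrier_vec n"
  shows "z \<bullet>c (x + complex_of_real t \<cdot>\<^sub>v y) = z \<bullet>c x + of_real t * (z \<bullet>c y)"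
  using assms
  by (simp add: conjugate_add_vec[of _ n] conjugate_smult_vec scalar_prod_add_distrib[of _ n])

lemma word_act_linear:
  assumes "mat_tuple d n X" "w \<in> words d" "u \<in> carrier_vec n" "v \<in> carrier_vec n"
  shows "word_act n X w (u + a \<cdot>\<^sub>v v) = word_act n X w u + a \<cdot>\<^sub>v word_act n X w v"
  using assms word_prod_carrier[OF assms(1,2)]
  by (simp add: word_act_def mult_add_distrib_mat_vec[of _ n n] mult_mat_vec[of _ n n])

text \<open>Two tuples of self-adjoint contractions. They are joined by a segment that consists of such tuples again, so
  that all words stay bounded by \<open>1\<close> along it.\<close>

locale hermitian_segment =
  fixes d n :: nat and X Y :: "nat \<Rightarrow> complex mat"
  assumes X: "mat_tuple d n X" "\<And>i. i < d \<Longrightarrow> self_adjoint (X i)" "\<And>i. i < d \<Longrightarrow> norm_bounded n (X i) 1"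
    and Y: "mat_tuple d n Y" "\<And>i. i < d \<Longrightarrow> self_adjoint (Y i)" "\<And>i. i < d \<Longrightarrow> norm_bounded n (Y i) 1"
begin

definition seg :: "real \<Rightarrow> nat \<Rightarrow> complex mat" where
  "seg t i = X i + complex_of_real t \<cdot>\<^sub>m (Y i - X i)"

lemma X_carrier: "i < d \<Longrightarrow> X i \<in> carrier_mat n n" and Y_carrier: "i < d \<Longrightarrow> Y i \<in> carrier_mat n n"
  using X(1) Y(1) by (auto simp: mat_tuple_def)

lemma seg_0: "i < d \<Longrightarrow> seg 0 i = X i" and seg_1: "i < d \<Longrightarrow> seg 1 i = Y i"
  using X_carrier[of i] Y_carrier[of i] by (auto simp: seg_def intro!: eq_matI)

lemma diff_carrier: "i < d \<Longrightarrow> Y i - X i \<in> carrier_mat n n"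
  using X_carrier by (intro minus_carrier_mat)

lemma diff_self_adjoint: "i < d \<Longrightarrow> self_adjoint (Y i - X i)"
  using X Y X_carrier Y_carrier by (intro self_adjoint_minus[of _ n]) auto

lemma diff_bounded: 
  assumes "i < d"
  shows "norm_bounded n (Y i - X i) 2"
proof -
  have c: "X i \<in> carrier_mat n n" "Y i \<in> carrier_mat n n"
    using X_carrier Y_carrier assms by auto
  have "norm_bounded n (Y i + (-1) \<cdot>\<^sub>m X i) (1 + cmod (-1) * 1)"
    using assms X Y c by (intro norm_bounded_add norm_bounded_smult) auto
  moreover have "Y i + (-1) \<cdot>\<^sub>m X i = Y i - X i"
    using c by (intro eq_matI) auto
  ultimately show ?thesis by simp
qed

lemma seg_tuple: "mat_tuple d n (seg t)"
  using X_carrier diff_carrier by (simp add: seg_def mat_tuple_def)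

lemma seg_self_adjoint: "i < d \<Longrightarrow> self_adjoint (seg t i)"
  unfolding seg_def using X X_carrier diff_carrier diff_self_adjoint
  by (intro self_adjoint_add[of _ n] self_adjoint_smult[of _ n]) auto

lemma seg_bounded:
  assumes i: "i < d" and t: "t \<in> {0..1}"
  shows "norm_bounded n (seg t i) 1"
proof -
  have c: "X i \<in> carrier_mat n n" "Y i \<in> carrier_mat n n"
    using X_carrier Y_carrier i by auto
  have "norm_bounded n (complex_of_real (1 - t) \<cdot>\<^sub>m X i + complex_of_real t \<cdot>\<^sub>m Y i)
      (cmod (complex_of_real (1 - t)) * 1 + cmod (complex_of_real t) * 1)"
    using X Y i c by (intro norm_bounded_add norm_bounded_smult) auto
  moreover have "complex_of_real (1 - t) \<cdot>\<^sub>m X i + complex_of_real t \<cdot>\<^sub>m Y i = seg t i"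
    using c by (intro eq_matI) (auto simp: seg_def algebra_simps)
  moreover have "cmod (complex_of_real (1 - t)) * 1 + cmod (complex_of_real t) * 1 = 1"
    using t by (auto simp del: of_real_diff)
  ultimately show ?thesis by simp
qed

lemma act_carrier [simp]: "w \<in> words d \<Longrightarrow> v \<in> carrier_vec n \<Longrightarrow> word_act n (seg t) w v \<in> carrier_vec n"
  by (rule word_act_carrier[OF seg_tuple])

lemma diff_mult_carrier [simp]: "k < d \<Longrightarrow> v \<in> carrier_vec n \<Longrightarrow> (Y k - X k) *\<^sub>v v \<in> carrier_vec n"
  by (rule mult_mat_vec_carrier[OF diff_carrier])

text \<open>The derivative of \<open>\<langle>Z\<^sup>w v, u\<rangle>\<close> along the segment \<open>Z = seg t\<close>: each letter of \<open>w\<close> in turn is replaced by its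
  increment, and the letters to its left are moved, reversed, to the other side of the inner product.\<close>

definition word_deriv :: "nat list \<Rightarrow> real \<Rightarrow> complex vec \<Rightarrow> complex vec \<Rightarrow> complex" where
  "word_deriv w t v u = (\<Sum>i<length w.
     ((Y (w ! i) - X (w ! i)) *\<^sub>v word_act n (seg t) (drop (Suc i) w) v)
       \<bullet>c word_act n (seg t) (rev (take i w)) u)"

lemma word_deriv_term_norm_le:
  assumes w: "w \<in> words d" "w' \<in> words d" "k < d" and t: "t \<in> {0..1}"
    and v: "v \<in> carrier_vec n" "u \<in> carrier_vec n"
  shows "cmod (((Y k - X k) *\<^sub>v word_act n (seg t) w v) \<bullet>c word_act n (seg t) w' u)
    \<le> 2 * euclid_norm v * euclid_norm u"
proof -
  have a: "euclid_norm (word_act n (seg t) w x) \<le> euclid_norm x"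
    if "w \<in> words d" "x \<in> carrier_vec n" for w x
    using word_act_norm_le[OF seg_tuple seg_bounded[OF _ t] _ that] by simp
  have "cmod (((Y k - X k) *\<^sub>v word_act n (seg t) w v) \<bullet>c word_act n (seg t) w' u)
      \<le> euclid_norm ((Y k - X k) *\<^sub>v word_act n (seg t) w v) * euclid_norm (word_act n (seg t) w' u)"
    using w v by (intro cscalar_prod_norm_le[of _ n]) auto
  also have "\<dots> \<le> (2 * euclid_norm v) * euclid_norm u"
  proof (rule mult_mono)
    have "euclid_norm ((Y k - X k) *\<^sub>v word_act n (seg t) w v) \<le> 2 * euclid_norm (word_act n (seg t) w v)"
      using w v diff_bounded by (intro norm_boundedD) auto
    with a[OF w(1) v(1)] show "euclid_norm ((Y k - X k) *\<^sub>v word_act n (seg t) w v) \<le> 2 * euclid_norm v"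
      by linarith
  qed (use a w v euclid_norm_nonneg in auto)
  finally show ?thesis .
qed

lemma word_deriv_norm_le:
  assumes w: "w \<in> words d" and t: "t \<in> {0..1}" and v: "v \<in> carrier_vec n" "u \<in> carrier_vec n"
  shows "cmod (word_deriv w t v u) \<le> real (length w) * (2 * euclid_norm v * euclid_norm u)"
proof -
  have "cmod (word_deriv w t v u) \<le> (\<Sum>i<length w. 2 * euclid_norm v * euclid_norm u)"
    unfolding word_deriv_def
    using w by (intro order_trans[OF norm_sum] sum_mono word_deriv_term_norm_le t v)
      (auto simp: words_take words_drop words_nth)
  then show ?thesis by simp
qed

text \<open>Induction on \<open>w\<close> with \<open>u\<close> arbitrary. Moving the first letter \<open>seg t k\<close> to the other side makes the second
  argument depend on \<open>t\<close>; since it does so affinely, expanding it leaves only forms with a constant second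
  argument and the scalar factor \<open>t\<close>.\<close>

lemma word_form_has_derivative:
  assumes "w \<in> words d" "v \<in> carrier_vec n" "u \<in> carrier_vec n"
  shows "((\<lambda>t. word_act n (seg t) w v \<bullet>c u) has_vector_derivative word_deriv w t v u) (at t within S)"
  using assms
proof (induction w arbitrary: u)
  case Nil
  then show ?case by (simp add: word_deriv_def)
next
  case (Cons k w)
  then have w: "k < d" "w \<in> words d" by auto
  let ?H = "Y k - X k" and ?a = "\<lambda>t. word_act n (seg t) w v"
  have Xk: "X k \<in> carrier_mat n n" using X w by (simp add: mat_tuple_def)
  note Hk = diff_carrier[OF w(1)]
  have a: "?a t \<in> carrier_vec n" for t
    using w Cons.prems by simp
  have seg_u: "seg t k *\<^sub>v x = X k *\<^sub>v x + complex_of_real t \<cdot>\<^sub>v (?H *\<^sub>v x)" if "x \<in> carrier_vec n" for t x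
    using that Xk Hk by (simp add: seg_def add_mult_distrib_mat_vec[of _ n n] smult_mult_mat_vec[of _ n n])
  have form: "word_act n (seg t) (k # w) v \<bullet>c u = ?a t \<bullet>c (X k *\<^sub>v u) + of_real t * (?a t \<bullet>c (?H *\<^sub>v u))" for t
  proof -
    have "word_act n (seg t) (k # w) v \<bullet>c u = (X k *\<^sub>v ?a t) \<bullet>c u + of_real t * ((?H *\<^sub>v ?a t) \<bullet>c u)"
      using Cons.prems w Xk Hk a[of t] seg_u[OF a]
      by (simp add: word_act_Cons[OF seg_tuple] cscalar_prod_add_left[of _ n])
    then show ?thesis
      using Cons.prems w Xk Hk a[of t] X(2) diff_self_adjoint by (simp add: self_adjoint_move[of _ n])
  qed
  have "((\<lambda>t. ?a t \<bullet>c (X k *\<^sub>v u) + of_real t * (?a t \<bullet>c (?H *\<^sub>v u))) has_vector_derivative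
      word_deriv w t v (X k *\<^sub>v u) + (of_real t * word_deriv w t v (?H *\<^sub>v u) + of_real 1 * (?a t \<bullet>c (?H *\<^sub>v u))))
      (at t within S)"
    using Cons w Xk Hk
    by (intro has_vector_derivative_add has_vector_derivative_mult has_vector_derivative_of_real) auto
  also have "word_deriv w t v (X k *\<^sub>v u) + (of_real t * word_deriv w t v (?H *\<^sub>v u) + of_real 1 * (?a t \<bullet>c (?H *\<^sub>v u)))
      = word_deriv w t v (seg t k *\<^sub>v u) + (?H *\<^sub>v ?a t) \<bullet>c u"
  proof -
    have "word_deriv w t v (seg t k *\<^sub>v u) = word_deriv w t v (X k *\<^sub>v u) + of_real t * word_deriv w t v (?H *\<^sub>v u)"
      unfolding word_deriv_def sum_distrib_left sum.distrib[symmetric] seg_u[OF Cons.prems(3)]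
    proof (intro sum.cong refl)
      fix i assume i: "i \<in> {..<length w}"
      have "(Y (w ! i) - X (w ! i)) *\<^sub>v word_act n (seg t) (drop (Suc i) w) v \<in> carrier_vec n"
        using w i Cons.prems by (intro diff_mult_carrier act_carrier) (auto simp: words_drop words_nth)
      then show "((Y (w ! i) - X (w ! i)) *\<^sub>v word_act n (seg t) (drop (Suc i) w) v) \<bullet>c
          word_act n (seg t) (rev (take i w)) (X k *\<^sub>v u + complex_of_real t \<cdot>\<^sub>v (?H *\<^sub>v u)) =
          ((Y (w ! i) - X (w ! i)) *\<^sub>v word_act n (seg t) (drop (Suc i) w) v) \<bullet>c
          word_act n (seg t) (rev (take i w)) (X k *\<^sub>v u) +
          of_real t * (((Y (w ! i) - X (w ! i)) *\<^sub>v word_act n (seg t) (drop (Suc i) w) v) \<bullet>c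
          word_act n (seg t) (rev (take i w)) (?H *\<^sub>v u))"
        using w Xk Hk Cons.prems
        by (simp add: word_act_linear[OF seg_tuple] words_take mult_mat_vec_carrier[OF Xk]
            cscalar_prod_add_right[of _ n])
    qed
    moreover have "(?H *\<^sub>v ?a t) \<bullet>c u = ?a t \<bullet>c (?H *\<^sub>v u)"
      using Hk a w Cons.prems diff_self_adjoint by (intro self_adjoint_move) auto
    ultimately show ?thesis by simp
  qed
  also have "\<dots> = word_deriv (k # w) t v u"
    using w Cons.prems
    by (simp add: word_deriv_def sum.lessThan_Suc_shift word_act_append[OF seg_tuple] words_take
        word_act_Cons[OF seg_tuple] del: sum.lessThan_Suc)
  finally show ?case unfolding form .
qed

end

section \<open>Term-by-term differentiation of a free power series\<close>

text \<open>Differentiation of unordered sums under a summable majorant of the derivatives, reduced to the theorem on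
  series by an enumeration of the index set.\<close>

lemma infsum_has_vector_derivative:
  fixes f :: "'a \<Rightarrow> real \<Rightarrow> 'b::banach"
  assumes A: "countable A" "infinite A" and S: "convex S"
    and der: "\<And>a t. a \<in> A \<Longrightarrow> t \<in> S \<Longrightarrow> (f a has_vector_derivative f' a t) (at t within S)"
    and bound: "\<And>a t. a \<in> A \<Longrightarrow> t \<in> S \<Longrightarrow> norm (f' a t) \<le> M a"
    and M: "M summable_on A"
    and f: "\<And>t. t \<in> S \<Longrightarrow> (\<lambda>a. f a t) summable_on A"
    and t: "t \<in> S"
  shows "((\<lambda>t. \<Sum>\<^sub>\<infinity>a\<in>A. f a t) has_vector_derivative (\<Sum>\<^sub>\<infinity>a\<in>A. f' a t)) (at t within S)"
proof -
  define e where "e = from_nat_into A"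
  have e: "bij_betw e UNIV A"
    unfolding e_def by (rule bij_betw_from_nat_into[OF A])
  have eA: "e n \<in> A" for n
    using e by (auto simp: bij_betw_def)
  have sums: "(\<lambda>n. h (e n)) sums infsum h A" if "h summable_on A" for h :: "'a \<Rightarrow> 'b"
  proof -
    have "(h has_sum infsum h A) A" using that by simp
    then have "((\<lambda>n. h (e n)) has_sum infsum h A) UNIV"
      using has_sum_reindex_bij_betw[OF e, of h] by simp
    then show ?thesis by (rule has_sum_imp_sums)
  qed
  have "(\<lambda>n. M (e n)) summable_on UNIV"
    using M summable_on_reindex_bij_betw[OF e, of M] by simp
  then have M': "summable (\<lambda>n. M (e n))"
    by (rule summable_on_imp_summable)
  have f': "(\<lambda>a. f' a s) summable_on A" if "s \<in> S" for s
  proof (rule abs_summable_summable, rule summable_on_comparison_test[OF M])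
    show "norm (f' a s) \<le> M a" if "a \<in> A" for a
      using bound[OF that \<open>s \<in> S\<close>] .
  qed auto
  have unif: "uniform_limit S (\<lambda>n s. \<Sum>i<n. f' (e i) s) (\<lambda>s. \<Sum>i. f' (e i) s) sequentially"
    by (rule Weierstrass_m_test[OF _ M']) (use bound eA in auto)
  have lim: "(\<Sum>i. f' (e i) s) = (\<Sum>\<^sub>\<infinity>a\<in>A. f' a s)" if "s \<in> S" for s
    using sums[OF f'[OF that]] by (simp add: sums_iff)
  have "\<exists>g. \<forall>s\<in>S. (\<lambda>n. f (e n) s) sums g s \<and>
      (g has_derivative (\<lambda>h. h *\<^sub>R (\<Sum>\<^sub>\<infinity>a\<in>A. f' a s))) (at s within S)"
  proof (rule has_derivative_series[OF S, where f' = "\<lambda>n s h. h *\<^sub>R f' (e n) s"])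
    show "(f (e n) has_derivative (\<lambda>h. h *\<^sub>R f' (e n) s)) (at s within S)" if "s \<in> S" for n s
      using der[OF eA that] by (simp add: has_vector_derivative_def)
    show "\<forall>\<^sub>F n in sequentially. \<forall>s\<in>S. \<forall>h.
        norm ((\<Sum>i<n. h *\<^sub>R f' (e i) s) - h *\<^sub>R (\<Sum>\<^sub>\<infinity>a\<in>A. f' a s)) \<le> r * norm h" if "r > 0" for r
      using uniform_limitD[OF unif that]
    proof eventually_elim
      case (elim n)
      show ?case
      proof (intro ballI allI)
        fix s h assume s: "s \<in> S"
        have "norm ((\<Sum>i<n. h *\<^sub>R f' (e i) s) - h *\<^sub>R (\<Sum>\<^sub>\<infinity>a\<in>A. f' a s))
            = norm h * dist (\<Sum>i<n. f' (e i) s) (\<Sum>i. f' (e i) s)"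
          by (simp add: lim[OF s] dist_norm flip: scaleR_sum_right scaleR_diff_right)
        also have "\<dots> \<le> norm h * r"
          using elim s by (intro mult_left_mono) (auto intro: less_imp_le)
        finally show "norm ((\<Sum>i<n. h *\<^sub>R f' (e i) s) - h *\<^sub>R (\<Sum>\<^sub>\<infinity>a\<in>A. f' a s)) \<le> r * norm h"
          by (simp add: mult.commute)
      qed
    qed
    show "(\<lambda>n. f (e n) t) sums (\<Sum>\<^sub>\<infinity>a\<in>A. f a t)"
      by (rule sums[OF f[OF t]])
  qed (rule t)
  then obtain g where g: "\<forall>s\<in>S. (\<lambda>n. f (e n) s) sums g s \<and>
      (g has_derivative (\<lambda>h. h *\<^sub>R (\<Sum>\<^sub>\<infinity>a\<in>A. f' a s))) (at s within S)"
    by auto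
  have "(\<Sum>\<^sub>\<infinity>a\<in>A. f a s) = g s" if "s \<in> S" for s
    by (rule sums_unique2[OF sums[OF f[OF that]] conjunct1[OF bspec[OF g that]]])
  then show ?thesis
    unfolding has_vector_derivative_def
    by (rule has_derivative_transform[OF t _ conjunct2[OF bspec[OF g t]]])
qed

lemma has_sum_finite_sum:
  fixes f :: "'a \<Rightarrow> 'b \<Rightarrow> 'c::real_normed_vector"
  assumes "finite P" "\<And>p. p \<in> P \<Longrightarrow> (f p has_sum g p) A"
  shows "((\<lambda>a. \<Sum>p\<in>P. f p a) has_sum (\<Sum>p\<in>P. g p)) A"
  using assms by (induction P rule: finite_induct) (auto intro!: has_sum_add)

lemma countable_words [simp]: "countable (words d)"
  unfolding words_def by simp

lemma infinite_words:
  assumes "1 \<le> d"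
  shows "infinite (words d)"
proof -
  have "range (\<lambda>m. replicate m (0::nat)) \<subseteq> words d"
    using assms by (auto simp: words_def)
  moreover have "inj (\<lambda>m. replicate m (0::nat))"
    by (rule injI) (metis length_replicate)
  ultimately show ?thesis
    using infinite_super range_inj_infinite by blast
qed

text \<open>A word with a marked position is the same as a letter together with the word to its left, read backwards,
  and the word to its right. This is how the coefficients \<open>c (rev I @ k # J)\<close> enter.\<close>

lemma bij_betw_word_positions:
  "bij_betw (\<lambda>(w, i). (w ! i, rev (take i w), drop (Suc i) w))
     (SIGMA w:words d. {..<length w}) ({..<d} \<times> words d \<times> words d)"
  by (rule bij_betw_byWitness[where f' = "\<lambda>(k, I, J). (rev I @ k # J, length I)"])
    (auto simp: words_take words_drop words_nth nth_append id_take_nth_drop[symmetric])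

lemma summable_on_word_positions:
  fixes g :: "nat list \<Rightarrow> real"
  assumes g: "\<And>w. w \<in> words d \<Longrightarrow> 0 \<le> g w" and s: "(\<lambda>w. real (length w) * g w) summable_on words d"
  shows "(\<lambda>(w, i). g w) summable_on (SIGMA w:words d. {..<length w})"
  by (rule summable_on_SigmaI[where g = "\<lambda>w. real (length w) * g w"])
    (use g s in \<open>auto intro!: has_sum_finiteI\<close>)

lemma summable_on_split_words:
  fixes g :: "nat list \<Rightarrow> real"
  assumes g: "\<And>w. w \<in> words d \<Longrightarrow> 0 \<le> g w" and s: "(\<lambda>w. real (length w) * g w) summable_on words d"
    and k: "k < d"
  shows "(\<lambda>(I, J). g (rev I @ k # J)) summable_on words d \<times> words d"
proof -
  have "(\<lambda>(k, I, J). g (rev I @ k # J)) summable_on {..<d} \<times> words d \<times> words d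
      \<longleftrightarrow> (\<lambda>(w, i). g w) summable_on (SIGMA w:words d. {..<length w})"
    by (subst summable_on_reindex_bij_betw[OF bij_betw_word_positions, symmetric], rule summable_on_cong)
      (auto simp: id_take_nth_drop[symmetric])
  then have "(\<lambda>(k, I, J). g (rev I @ k # J)) summable_on {..<d} \<times> words d \<times> words d"
    using summable_on_word_positions[of d g] g s by simp
  then have "(\<lambda>(k, I, J). g (rev I @ k # J)) summable_on Pair k ` (words d \<times> words d)"
    by (rule summable_on_subset_banach) (use k in auto)
  then show ?thesis
    by (subst (asm) summable_on_reindex) (auto simp: inj_on_def o_def case_prod_unfold)
qed

lemma free_series_form:
  assumes X: "mat_tuple d n X" and conv: "series_converges d c n X"
    and v: "v \<in> carrier_vec n" "u \<in> carrier_vec n"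
  shows "((\<lambda>w. c w * (word_act n X w v \<bullet>c u)) has_sum (free_series d c n X *\<^sub>v v) \<bullet>c u) (words d)"
proof -
  let ?e = "\<lambda>i j w. (c w \<cdot>\<^sub>m word_prod n X w) $$ (i, j)"
  have F: "free_series d c n X \<in> carrier_mat n n" by (simp add: free_series_def)
  have entry: "(?e i j has_sum free_series d c n X $$ (i, j)) (words d)" if "i < n" "j < n" for i j
    using conv that by (simp add: series_converges_def free_series_def)
  have "((\<lambda>w. \<Sum>i<n. \<Sum>j<n. ?e i j w * v $ j * cnj (u $ i)) has_sum
      (\<Sum>i<n. \<Sum>j<n. free_series d c n X $$ (i, j) * v $ j * cnj (u $ i))) (words d)"
    by (intro has_sum_finite_sum has_sum_cmult_left entry) auto
  also have "(\<Sum>i<n. \<Sum>j<n. free_series d c n X $$ (i, j) * v $ j * cnj (u $ i)) = (free_series d c n X *\<^sub>v v) \<bullet>c u"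
    using quadratic_form_eq_sum[OF F v] by simp
  also have "((\<lambda>w. \<Sum>i<n. \<Sum>j<n. ?e i j w * v $ j * cnj (u $ i)) has_sum (free_series d c n X *\<^sub>v v) \<bullet>c u) (words d)
      \<longleftrightarrow> ?thesis"
  proof (rule has_sum_cong)
    fix w assume w: "w \<in> words d"
    note P = word_prod_carrier[OF X w]
    show "(\<Sum>i<n. \<Sum>j<n. ?e i j w * v $ j * cnj (u $ i)) = c w * (word_act n X w v \<bullet>c u)"
      unfolding word_act_def quadratic_form_eq_sum[OF P v] sum_distrib_left
      using P by (intro sum.cong refl) auto
  qed
  finally show ?thesis .
qed

locale convergent_segment = hermitian_segment +
  fixes c :: "nat list \<Rightarrow> complex"
  assumes d: "1 \<le> d"
    and c_summable: "(\<lambda>w. cmod (c w)) summable_on words d"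
    and c_length_summable: "(\<lambda>w. real (length w) * cmod (c w)) summable_on words d"
begin

lemma form_has_derivative:
  assumes v: "v \<in> carrier_vec n" and t: "t \<in> {0..1}"
  shows "((\<lambda>t. \<Sum>\<^sub>\<infinity>w\<in>words d. c w * (word_act n (seg t) w v \<bullet>c v)) has_vector_derivative
    (\<Sum>\<^sub>\<infinity>w\<in>words d. c w * word_deriv w t v v)) (at t within {0..1})"
proof (rule infsum_has_vector_derivative[OF _ _ _ _ _ _ _ t])
  show "infinite (words d)" using infinite_words[OF d] .
  show "((\<lambda>t. c w * (word_act n (seg t) w v \<bullet>c v)) has_vector_derivative c w * word_deriv w s v v) (at s within {0..1})"
    if "w \<in> words d" for w s
    by (intro has_vector_derivative_mult_right word_form_has_derivative that v)
  show "cmod (c w * word_deriv w s v v) \<le> real (length w) * cmod (c w) * (2 * euclid_norm v * euclid_norm v)"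
    if "w \<in> words d" "s \<in> {0..1}" for w s
    using mult_left_mono[OF word_deriv_norm_le[OF that v v], of "cmod (c w)"] by (simp add: norm_mult algebra_simps)
  show "(\<lambda>w. real (length w) * cmod (c w) * (2 * euclid_norm v * euclid_norm v)) summable_on words d"
    by (intro summable_on_cmult_left c_length_summable)
  show "(\<lambda>w. c w * (word_act n (seg s) w v \<bullet>c v)) summable_on words d" if s: "s \<in> {0..1}" for s
  proof (rule abs_summable_summable, rule summable_on_comparison_test)
    show "(\<lambda>w. cmod (c w) * (euclid_norm v * euclid_norm v)) summable_on words d"
      by (intro summable_on_cmult_left c_summable)
    show "cmod (c w * (word_act n (seg s) w v \<bullet>c v)) \<le> cmod (c w) * (euclid_norm v * euclid_norm v)"
      if w: "w \<in> words d" for w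
    proof -
      have "cmod (word_act n (seg s) w v \<bullet>c v) \<le> euclid_norm (word_act n (seg s) w v) * euclid_norm v"
        using w v by (intro cscalar_prod_norm_le[of _ n]) auto
      also have "\<dots> \<le> euclid_norm v * euclid_norm v"
        using word_act_norm_le[OF seg_tuple seg_bounded[OF _ s] _ w v] by (intro mult_right_mono) auto
      finally show ?thesis by (simp add: norm_mult mult_left_mono)
    qed
  qed auto
qed auto

text \<open>Regrouping the derivative by marked letters exhibits it as the pairing of the kernels
  \<open>c (rev I @ k # J)\<close> with the Gram kernels of the increments.\<close>

lemma derivative_split_sum:
  assumes v: "v \<in> carrier_vec n" and t: "t \<in> {0..1}"
  shows "(\<Sum>\<^sub>\<infinity>w\<in>words d. c w * word_deriv w t v v) =
    (\<Sum>k<d. \<Sum>\<^sub>\<infinity>(I, J)\<in>words d \<times> words d. c (rev I @ k # J) *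
       (((Y k - X k) *\<^sub>v word_act n (seg t) J v) \<bullet>c word_act n (seg t) I v))"
proof -
  define T where "T = (\<lambda>(k, I, J). c (rev I @ k # J) *
       (((Y k - X k) *\<^sub>v word_act n (seg t) J v) \<bullet>c word_act n (seg t) I v))"
  let ?D = "SIGMA w:words d. {..<length w}"
  let ?p = "\<lambda>(w, i). (w ! i, rev (take i w), drop (Suc i) w)"
  have word_terms: "c w * word_deriv w t v v = (\<Sum>i<length w. T (?p (w, i)))" if "w \<in> words d" for w
    by (auto simp: T_def word_deriv_def sum_distrib_left id_take_nth_drop[symmetric] intro!: sum.cong)
  have T_le: "cmod (T (?p x)) \<le> (case x of (w, i) \<Rightarrow> cmod (c w)) * (2 * euclid_norm v * euclid_norm v)"
    if "x \<in> ?D" for x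
  proof -
    obtain w i where x: "x = (w, i)" by fastforce
    show ?thesis
      using that unfolding x T_def
      by (auto simp: norm_mult id_take_nth_drop[symmetric] words_take words_drop words_nth
          intro!: mult_left_mono word_deriv_term_norm_le v t)
  qed
  have "(\<lambda>x. (case x of (w, i) \<Rightarrow> cmod (c w)) * (2 * euclid_norm v * euclid_norm v)) summable_on ?D"
    by (intro summable_on_cmult_left summable_on_word_positions c_length_summable) auto
  then have "(\<lambda>x. T (?p x)) abs_summable_on ?D"
    by (rule summable_on_comparison_test) (use T_le in auto)
  then have s: "(\<lambda>x. T (?p x)) summable_on ?D"
    by (rule abs_summable_summable)
  have "(\<Sum>\<^sub>\<infinity>w\<in>words d. c w * word_deriv w t v v) = (\<Sum>\<^sub>\<infinity>w\<in>words d. \<Sum>\<^sub>\<infinity>i\<in>{..<length w}. T (?p (w, i)))"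
    by (rule infsum_cong) (simp add: word_terms)
  also have "\<dots> = (\<Sum>\<^sub>\<infinity>x\<in>?D. T (?p x))"
    by (rule infsum_Sigma_banach[OF s])
  also have "\<dots> = infsum T ({..<d} \<times> words d \<times> words d)"
    by (rule infsum_reindex_bij_betw[OF bij_betw_word_positions])
  also have "\<dots> = (\<Sum>\<^sub>\<infinity>k\<in>{..<d}. infsum (\<lambda>y. T (k, y)) (words d \<times> words d))"
    by (rule infsum_Sigma_banach[symmetric])
      (use s summable_on_reindex_bij_betw[OF bij_betw_word_positions, of T d] in simp)
  finally show ?thesis
    by (simp add: T_def case_prod_unfold)
qed

end

section \<open>The derivative of the quadratic form and its sign\<close>

lemma closed_complex_nonneg: "closed {z::complex. 0 \<le> z}"
proof -
  have "{z::complex. 0 \<le> z} = {z. 0 \<le> Re z} \<inter> {z. Im z = 0}"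
    by (auto simp: less_eq_complex_def)
  then show ?thesis
    by (auto intro!: closed_Int closed_Collect_le closed_Collect_eq continuous_intros)
qed

text \<open>Squares \<open>F \<times> F\<close> are cofinal among the finite subsets of \<open>A \<times> A\<close>, and the nonnegative numbers are closed.\<close>

lemma infsum_square_nonneg:
  fixes h :: "'a \<Rightarrow> 'a \<Rightarrow> complex"
  assumes s: "(\<lambda>(I, J). h I J) summable_on A \<times> A"
    and nonneg: "\<And>F. finite F \<Longrightarrow> F \<subseteq> A \<Longrightarrow> 0 \<le> (\<Sum>I\<in>F. \<Sum>J\<in>F. h I J)"
  shows "0 \<le> (\<Sum>\<^sub>\<infinity>(I, J)\<in>A \<times> A. h I J)"
proof (rule ccontr)
  let ?f = "\<lambda>(I, J). h I J" and ?C = "{z::complex. 0 \<le> z}"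
  assume "\<not> 0 \<le> (\<Sum>\<^sub>\<infinity>(I, J)\<in>A \<times> A. h I J)"
  then have S: "infsum ?f (A \<times> A) \<in> - ?C" by simp
  have "(sum ?f \<longlongrightarrow> infsum ?f (A \<times> A)) (finite_subsets_at_top (A \<times> A))"
    using s by (rule infsum_tendsto)
  then have "eventually (\<lambda>P. sum ?f P \<in> - ?C) (finite_subsets_at_top (A \<times> A))"
    by (rule topological_tendstoD[OF _ open_Compl[OF closed_complex_nonneg] S])
  then obtain P where P: "finite P" "P \<subseteq> A \<times> A"
    and out: "\<And>Q. finite Q \<Longrightarrow> P \<subseteq> Q \<Longrightarrow> Q \<subseteq> A \<times> A \<Longrightarrow> sum ?f Q \<in> - ?C"
    unfolding eventually_finite_subsets_at_top by metis
  \<comment> \<open>Squares are cofinal among the finite subsets of the product.\<close>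
  define F where "F = fst ` P \<union> snd ` P"
  have F: "finite F" "F \<subseteq> A" "P \<subseteq> F \<times> F"
    using P unfolding F_def by (simp, auto, metis fst_conv image_eqI, metis snd_conv image_eqI)
  have "sum ?f (F \<times> F) \<in> - ?C"
    using F by (intro out) auto
  then show False
    using nonneg[OF F(1,2)] by (simp add: sum.cartesian_product)
qed

lemma increasing_complex_if_deriv_nonneg:
  fixes \<phi> :: "real \<Rightarrow> complex"
  assumes der: "\<And>t. t \<in> {0..1} \<Longrightarrow> (\<phi> has_vector_derivative \<phi>' t) (at t within {0..1})"
    and nonneg: "\<And>t. t \<in> {0..1} \<Longrightarrow> 0 \<le> \<phi>' t"
  shows "\<phi> 0 \<le> \<phi> 1"
proof -
  have p: "0 \<le> Re (\<phi>' t)" "Im (\<phi>' t) = 0" if "t \<in> {0..1}" for t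
    using nonneg[OF that] by (auto simp: less_eq_complex_def)
  have mv: "\<exists>x\<in>{0<..<1}. g 1 - g 0 = g' x"
    if "\<And>t. t \<in> {0..1} \<Longrightarrow> (g has_vector_derivative g' t) (at t within {0..1})"
    for g g' :: "real \<Rightarrow> real"
    using mvt_simple[of 0 1 g "\<lambda>x h. h * g' x"] that by (simp add: has_vector_derivative_def)
  obtain x where x: "x \<in> {0<..<1}" "Re (\<phi> 1) - Re (\<phi> 0) = Re (\<phi>' x)"
    using mv[OF bounded_linear.has_vector_derivative[OF bounded_linear_Re der]] by auto
  obtain y where y: "y \<in> {0<..<1}" "Im (\<phi> 1) - Im (\<phi> 0) = Im (\<phi>' y)"
    using mv[OF bounded_linear.has_vector_derivative[OF bounded_linear_Im der]] by auto
  show ?thesis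
    using p[of x] p[of y] x y by (simp add: less_eq_complex_def)
qed

lemma deriv_nonneg_if_increments_nonneg:
  fixes \<phi> :: "real \<Rightarrow> complex"
  assumes der: "(\<phi> has_vector_derivative D) (at 0 within {0..1})"
    and incr: "\<And>t. t \<in> {0..1} \<Longrightarrow> \<phi> 0 \<le> \<phi> t"
  shows "0 \<le> D"
proof -
  have lim: "((\<lambda>t. (g t - g 0) / (t - 0)) \<longlongrightarrow> D') (at_right 0)"
    if "(g has_vector_derivative D') (at 0 within {0..1})" for g :: "real \<Rightarrow> real" and D'
    using that by (simp add: has_real_derivative_iff_has_vector_derivative[symmetric]
        has_field_derivative_iff at_within_Icc_at_right)
  have ev: "eventually (\<lambda>t::real. t \<in> {0<..<1}) (at_right 0)"
    by (rule eventually_at_right_real) simp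
  have "0 \<le> Re D"
  proof (rule tendsto_lowerbound)
    show "((\<lambda>t. (Re (\<phi> t) - Re (\<phi> 0)) / (t - 0)) \<longlongrightarrow> Re D) (at_right 0)"
      by (rule lim[OF bounded_linear.has_vector_derivative[OF bounded_linear_Re der]])
    show "\<forall>\<^sub>F t in at_right 0. 0 \<le> (Re (\<phi> t) - Re (\<phi> 0)) / (t - 0)"
      using ev by eventually_elim (use incr in \<open>auto simp: less_eq_complex_def\<close>)
  qed simp
  moreover have "Im D = 0"
  proof (rule tendsto_unique)
    show "((\<lambda>t. (Im (\<phi> t) - Im (\<phi> 0)) / (t - 0)) \<longlongrightarrow> Im D) (at_right 0)"
      by (rule lim[OF bounded_linear.has_vector_derivative[OF bounded_linear_Im der]])
    show "((\<lambda>t. (Im (\<phi> t) - Im (\<phi> 0)) / (t - 0)) \<longlongrightarrow> 0) (at_right 0)"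
    proof (rule tendsto_eventually)
      show "\<forall>\<^sub>F t in at_right 0. (Im (\<phi> t) - Im (\<phi> 0)) / (t - 0) = 0"
        using ev
      proof eventually_elim
        case (elim t)
        then show ?case using incr[of t] by (simp add: less_eq_complex_def)
      qed
    qed
  qed simp
  ultimately show ?thesis by (simp add: less_eq_complex_def)
qed

context convergent_segment
begin

abbreviation deriv_term :: "nat \<Rightarrow> real \<Rightarrow> complex vec \<Rightarrow> nat list \<Rightarrow> nat list \<Rightarrow> complex" where
  "deriv_term k t v I J \<equiv> c (rev I @ k # J) *
     (((Y k - X k) *\<^sub>v word_act n (seg t) J v) \<bullet>c word_act n (seg t) I v)"

lemma deriv_term_summable:
  assumes v: "v \<in> carrier_vec n" and t: "t \<in> {0..1}" and k: "k < d"
  shows "(\<lambda>(I, J). deriv_term k t v I J) summable_on words d \<times> words d"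
proof (rule abs_summable_summable, rule summable_on_comparison_test)
  show "(\<lambda>x. (case x of (I, J) \<Rightarrow> cmod (c (rev I @ k # J))) * (2 * euclid_norm v * euclid_norm v)) summable_on words d \<times> words d"
    by (intro summable_on_cmult_left summable_on_split_words[of d "\<lambda>w. cmod (c w)"] c_length_summable k) auto
  show "cmod (case x of (I, J) \<Rightarrow> deriv_term k t v I J) \<le>
      (case x of (I, J) \<Rightarrow> cmod (c (rev I @ k # J))) * (2 * euclid_norm v * euclid_norm v)"
    if "x \<in> words d \<times> words d" for x
    using that k by (auto simp: norm_mult intro!: mult_left_mono word_deriv_term_norm_le v t)
qed auto

text \<open>By the Schur product theorem the derivative is nonnegative along the whole segment.\<close>

lemma series_form_increasing:
  assumes psd: "\<And>k. k < d \<Longrightarrow> infinite_psd (words d) (\<lambda>I J. c (rev I @ k # J))"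
    and le: "tuple_le d X Y" and v: "v \<in> carrier_vec n"
  shows "(\<Sum>\<^sub>\<infinity>w\<in>words d. c w * (word_act n (seg 0) w v \<bullet>c v)) \<le>
    (\<Sum>\<^sub>\<infinity>w\<in>words d. c w * (word_act n (seg 1) w v \<bullet>c v))"
proof (rule increasing_complex_if_deriv_nonneg[OF form_has_derivative[OF v]])
  fix t :: real assume t: "t \<in> {0..1}"
  have "0 \<le> (\<Sum>\<^sub>\<infinity>(I, J)\<in>words d \<times> words d. deriv_term k t v I J)" if k: "k < d" for k
  proof (rule infsum_square_nonneg[OF deriv_term_summable[OF v t k]])
    fix F assume F: "finite F" "F \<subseteq> words d"
    have "psd_kernel F (\<lambda>I J. c (rev I @ k # J))"
      using psd[OF k] F unfolding infinite_psd_iff by simp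
    moreover have "psd_mat (Y k - X k)"
      using le k by (simp add: tuple_le_def mat_le_def)
    ultimately show "0 \<le> (\<Sum>I\<in>F. \<Sum>J\<in>F. deriv_term k t v I J)"
      using F v diff_carrier[OF k]
      by (intro psd_kernel_times_gram_nonneg[of F "\<lambda>I J. c (rev I @ k # J)"]) auto
  qed
  then show "0 \<le> (\<Sum>\<^sub>\<infinity>w\<in>words d. c w * word_deriv w t v v)"
    unfolding derivative_split_sum[OF v t] by (intro sum_nonneg) auto
qed

lemma derivative_nonneg_at_0:
  assumes v: "v \<in> carrier_vec n"
    and incr: "\<And>t. t \<in> {0..1} \<Longrightarrow> (\<Sum>\<^sub>\<infinity>w\<in>words d. c w * (word_act n (seg 0) w v \<bullet>c v)) \<le>
      (\<Sum>\<^sub>\<infinity>w\<in>words d. c w * (word_act n (seg t) w v \<bullet>c v))"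
  shows "0 \<le> (\<Sum>k<d. \<Sum>\<^sub>\<infinity>(I, J)\<in>words d \<times> words d. deriv_term k 0 v I J)"
  using deriv_nonneg_if_increments_nonneg[OF form_has_derivative[OF v] incr]
  by (simp add: derivative_split_sum[OF v])

end

lemma mat_le_iff_form_le:
  fixes A B :: "complex mat"
  assumes "A \<in> carrier_mat n n" "B \<in> carrier_mat n n"
  shows "mat_le A B \<longleftrightarrow> (\<forall>v\<in>carrier_vec n. (A *\<^sub>v v) \<bullet>c v \<le> (B *\<^sub>v v) \<bullet>c v)"
proof -
  have "((B - A) *\<^sub>v v) \<bullet>c v = (B *\<^sub>v v) \<bullet>c v - (A *\<^sub>v v) \<bullet>c v" if "v \<in> carrier_vec n" for v
    using assms that minus_carrier_mat[OF assms(1), of B]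
    by (simp add: quadratic_form_eq_sum left_diff_distrib sum_subtractf)
  then show ?thesis
    unfolding mat_le_def psd_mat_iff_form_nonneg[OF minus_carrier_mat[OF assms(1)]] by simp
qed

section \<open>Truncated Fock space\<close>

text \<open>Creation plus annihilation of the letter \<open>i\<close> on the space with basis \<open>ws\<close>; the intended \<open>ws\<close> lists all words
  up to some length, which truncates the full Fock space.\<close>

definition fock_mat :: "nat list list \<Rightarrow> nat \<Rightarrow> complex mat" where
  "fock_mat ws i = mat (length ws) (length ws)
     (\<lambda>(p, q). if ws ! p = i # ws ! q \<or> ws ! q = i # ws ! p then 1 else 0)"

definition vacuum :: "nat list list \<Rightarrow> complex vec" where
  "vacuum ws = vec (length ws) (\<lambda>p. if ws ! p = [] then 1 else 0)"

lemma fock_mat_carrier: "fock_mat ws i \<in> carrier_mat (length ws) (length ws)"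
  by (simp add: fock_mat_def)

lemma vacuum_carrier [simp]: "vacuum ws \<in> carrier_vec (length ws)"
  by (simp add: vacuum_def)

lemma fock_tuple: "mat_tuple d (length ws) (fock_mat ws)"
  by (simp add: mat_tuple_def fock_mat_carrier)

lemma fock_self_adjoint: "self_adjoint (fock_mat ws i)"
  by (rule self_adjointI[OF fock_mat_carrier]) (auto simp: fock_mat_def)

lemma fock_bounded: "norm_bounded (length ws) (fock_mat ws i) (real (length ws) * real (length ws))"
proof (rule norm_bounded_mono[OF norm_bounded_entry_sum[OF fock_mat_carrier]])
  have "(\<Sum>p<length ws. \<Sum>q<length ws. cmod (fock_mat ws i $$ (p, q))) \<le> (\<Sum>p<length ws. \<Sum>q<length ws. 1)"
    by (intro sum_mono) (auto simp: fock_mat_def)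
  then show "(\<Sum>p<length ws. \<Sum>q<length ws. cmod (fock_mat ws i $$ (p, q))) \<le> real (length ws) * real (length ws)"
    by simp
qed

text \<open>Applying the word \<open>J\<close> to the vacuum gives the basis vector of \<open>J\<close>, as long as it is within the truncation,
  plus components on shorter words only: each letter lengthens a word by at most one, and it does so only by
  creation.\<close>

lemma fock_leading_term:
  assumes ws: "distinct ws" "set ws = {w \<in> words d. length w \<le> N}"
    and J: "J \<in> words d" and p: "p < length ws" "length J \<le> length (ws ! p)"
  shows "word_act (length ws) (fock_mat ws) J (vacuum ws) $ p = (if ws ! p = J then 1 else 0)"
  using J p
proof (induction J arbitrary: p)
  case Nil
  then show ?case by (simp add: vacuum_def)
next
  case (Cons k J)
  let ?n = "length ws" and ?y = "word_act (length ws) (fock_mat ws) J (vacuum ws)"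
  have J: "k < d" "J \<in> words d" using Cons.prems by auto
  have y: "?y \<in> carrier_vec ?n"
    using word_act_carrier[OF fock_tuple J(2)] by simp
  have "word_act ?n (fock_mat ws) (k # J) (vacuum ws) $ p = (fock_mat ws k *\<^sub>v ?y) $ p"
    using J by (simp add: word_act_Cons[OF fock_tuple])
  also have "\<dots> = (\<Sum>q<?n. fock_mat ws k $$ (p, q) * ?y $ q)"
    using y Cons.prems fock_mat_carrier[of ws k]
    by (auto simp: scalar_prod_def row_def atLeast0LessThan intro!: sum.cong)
  \<comment> \<open>Annihilation would need a component on a word two letters longer, where \<open>?y\<close> vanishes.\<close>
  also have "\<dots> = (\<Sum>q<?n. if ws ! p = k # J \<and> ws ! q = J then 1 else 0)"
  proof (rule sum.cong[OF refl])
    fix q assume q: "q \<in> {..<?n}"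
    consider (create) "ws ! p = k # ws ! q" | (annihilate) "ws ! q = k # ws ! p"
      | (none) "ws ! p \<noteq> k # ws ! q" "ws ! q \<noteq> k # ws ! p" by blast
    then show "fock_mat ws k $$ (p, q) * ?y $ q = (if ws ! p = k # J \<and> ws ! q = J then 1 else 0)"
    proof cases
      case create
      then have "?y $ q = (if ws ! q = J then 1 else 0)"
        using Cons.prems q J by (intro Cons.IH) auto
      then show ?thesis using create q Cons.prems by (auto simp: fock_mat_def)
    next
      case annihilate
      then have "?y $ q = (if ws ! q = J then 1 else 0)"
        using Cons.prems q J by (intro Cons.IH) auto
      moreover have "ws ! q \<noteq> J" "ws ! p \<noteq> k # J \<or> ws ! q \<noteq> J"
        using annihilate Cons.prems by auto
      ultimately show ?thesis by simp
    next
      case none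
      then show ?thesis using q Cons.prems by (auto simp: fock_mat_def)
    qed
  qed
  also have "\<dots> = (if ws ! p = k # J then 1 else 0)"
  proof (cases "ws ! p = k # J")
    case True
    have "ws ! p \<in> set ws" using Cons.prems by simp
    then have "J \<in> set ws" using True by (auto simp: ws(2))
    then obtain q where q: "q < ?n" "ws ! q = J" by (auto simp: in_set_conv_nth)
    have "(\<Sum>q'<?n. if ws ! p = k # J \<and> ws ! q' = J then 1 else 0) = (\<Sum>q'<?n. if q' = q then 1 else (0::complex))"
      using True q ws(1) by (intro sum.cong) (auto simp: nth_eq_iff_index_eq)
    then show ?thesis using True q by simp
  qed simp
  finally show ?case .
qed

lemma word_act_smult:
  assumes "mat_tuple d n X" "w \<in> words d" "v \<in> carrier_vec n"
  shows "word_act n (\<lambda>i. a \<cdot>\<^sub>m X i) w v = a ^ length w \<cdot>\<^sub>v word_act n X w v"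
  using assms
proof (induction w)
  case Nil
  then show ?case by simp
next
  case (Cons k w)
  have X': "mat_tuple d n (\<lambda>i. a \<cdot>\<^sub>m X i)" and Xk: "X k \<in> carrier_mat n n"
    using Cons.prems by (auto simp: mat_tuple_def)
  have y: "word_act n X w v \<in> carrier_vec n"
    using Cons.prems by auto
  show ?case
    using Cons X' Xk y
    by (simp add: word_act_Cons[of d] smult_mult_mat_vec[of _ n n] mult_mat_vec[of _ n n] smult_smult_assoc mult.commute)
qed

text \<open>Finitely many prescribed values \<open>a J\<close> are approximated by matrix coefficients of small self-adjoint tuples,
  uniformly over all words \<open>J\<close>. For the scaled tuple \<open>s A\<close> the vector \<open>u\<close> has the entry
  \<open>cnj (a w) / s ^ length w\<close> at the word \<open>w\<close>. This compensates the factor \<open>s ^ length J\<close> of the leading term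
  exactly, while every other contribution comes from a word shorter than \<open>J\<close> and keeps a positive power of
  \<open>s\<close>.\<close>

lemma fock_interpolation:
  fixes a :: "nat list \<Rightarrow> complex"
  assumes F: "finite F" "F \<subseteq> words d" and a: "\<And>w. w \<notin> F \<Longrightarrow> a w = 0"
  obtains n :: nat and A e L C where "mat_tuple d n A" "\<And>i. i < d \<Longrightarrow> self_adjoint (A i)"
    "\<And>i. i < d \<Longrightarrow> norm_bounded n (A i) L" "1 \<le> L" "0 \<le> C" "e \<in> carrier_vec n"
    "\<And>s. 0 < s \<Longrightarrow> s * L \<le> 1 \<Longrightarrow> \<exists>u\<in>carrier_vec n. \<forall>J\<in>words d.
       cmod (word_act n (\<lambda>i. complex_of_real s \<cdot>\<^sub>m A i) J e \<bullet>c u - a J) \<le> C * s"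
proof -
  define N where "N = Max (insert 0 (length ` F))"
  have N: "length w \<le> N" if "w \<in> F" for w
    using F that by (auto simp: N_def)
  have "{w \<in> words d. length w \<le> N} = {w. set w \<subseteq> {..<d} \<and> length w \<le> N}"
    by (auto simp: words_def)
  then have "finite {w \<in> words d. length w \<le> N}"
    by (simp only: finite_lists_length_le finite_lessThan)
  then obtain ws where ws: "distinct ws" "set ws = {w \<in> words d. length w \<le> N}"
    using finite_distinct_list[of "{w \<in> words d. length w \<le> N}"] by auto
  define n where "n = length ws"
  define L where "L = real n * real n"
  have "[] \<in> set ws" by (simp add: ws)
  then have "n \<ge> 1" by (cases ws) (auto simp: n_def)
  then have L: "1 \<le> L"
    using mult_mono[of 1 "real n" 1 "real n"] by (simp add: L_def)
  define C where "C = (\<Sum>p<n. cmod (a (ws ! p))) * (L ^ N * L * euclid_norm (vacuum ws))"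
  define y where "y = (\<lambda>J. word_act n (fock_mat ws) J (vacuum ws))"
  have lens: "length (ws ! p) \<le> N" if "p < n" for p
    using nth_mem[of p ws] that by (simp add: ws n_def)
  have y: "y J \<in> carrier_vec n" if "J \<in> words d" for J
    using word_act_carrier[OF fock_tuple that] by (simp add: y_def n_def)
  have y_le: "cmod (y J $ p) \<le> L ^ length J * euclid_norm (vacuum ws)" if "J \<in> words d" "p < n" for J p
  proof -
    have "cmod (y J $ p) \<le> euclid_norm (y J)"
      using that y[OF that(1)]
      by (simp add: euclid_norm_L2_set) (rule member_le_L2_set[where f="\<lambda>i. cmod (y J $ i)"], auto)
    also have "\<dots> \<le> L ^ length J * euclid_norm (vacuum ws)"
      unfolding y_def n_def using that
      by (intro word_act_norm_le[OF fock_tuple]) (auto simp: L_def n_def intro: fock_bounded)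
    finally show ?thesis .
  qed
  have lead: "y J $ p = (if ws ! p = J then 1 else 0)"
    if "J \<in> words d" "p < n" "length J \<le> length (ws ! p)" for J p
    unfolding y_def n_def using that by (intro fock_leading_term[OF ws]) (auto simp: n_def)
  have appr: "\<exists>u\<in>carrier_vec n. \<forall>J\<in>words d.
       cmod (word_act n (\<lambda>i. complex_of_real s \<cdot>\<^sub>m fock_mat ws i) J (vacuum ws) \<bullet>c u - a J) \<le> C * s"
    if s: "0 < s" "s * L \<le> 1" for s
  proof (intro bexI ballI)
    \<comment> \<open>The weights undo the scaling of the leading terms by \<open>s ^ length J\<close>.\<close>
    define u where "u = vec n (\<lambda>p. cnj (a (ws ! p)) / of_real s ^ length (ws ! p))"
    show u: "u \<in> carrier_vec n" by (simp add: u_def)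
    fix J assume J: "J \<in> words d"
    have form: "word_act n (\<lambda>i. complex_of_real s \<cdot>\<^sub>m fock_mat ws i) J (vacuum ws) \<bullet>c u =
        (\<Sum>p<n. a (ws ! p) * (of_real s ^ length J / of_real s ^ length (ws ! p) * y J $ p))"
      using J y[OF J] word_act_smult[OF fock_tuple J, of "vacuum ws" ws "of_real s"]
      unfolding cscalar_prod_eq_sum[OF u]
      by (auto simp: u_def n_def y_def intro!: sum.cong)
    have aJ: "a J = (\<Sum>p<n. a (ws ! p) * (if ws ! p = J then 1 else 0))"
    proof (cases "J \<in> set ws")
      case True
      then obtain q where q: "q < n" "ws ! q = J" by (auto simp: in_set_conv_nth n_def)
      have "(\<Sum>p<n. a (ws ! p) * (if ws ! p = J then 1 else 0)) = (\<Sum>p<n. if p = q then a J else 0)"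
        using q ws(1) by (intro sum.cong) (auto simp: nth_eq_iff_index_eq n_def)
      then show ?thesis using q by simp
    next
      case False
      have "J \<notin> F" using False N J by (auto simp: ws)
      moreover have "ws ! p \<noteq> J" if "p < n" for p
        using nth_mem[of p ws] that False by (auto simp: n_def)
      ultimately show ?thesis using a by simp
    qed
    have term_le: "cmod (of_real s ^ length J / of_real s ^ length (ws ! p) * y J $ p - (if ws ! p = J then 1 else 0))
        \<le> s * (L ^ N * L * euclid_norm (vacuum ws))" if p: "p < n" for p
    proof (cases "length J \<le> length (ws ! p)")
      case True
      have "of_real s ^ length J / of_real s ^ length (ws ! p) * y J $ p - (if ws ! p = J then 1 else 0) = (0::complex)"
        using lead[OF J p True] s by auto
      then show ?thesis using s L by simp
    next
      case False
      then obtain m where m: "length J = length (ws ! p) + Suc m"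
        using less_imp_Suc_add by fastforce
      have "cmod (of_real s ^ length J / of_real s ^ length (ws ! p) * y J $ p) = s ^ Suc m * cmod (y J $ p)"
        using s by (simp add: m norm_mult norm_divide norm_power power_add)
      also have "\<dots> \<le> s ^ Suc m * (L ^ length J * euclid_norm (vacuum ws))"
        using s y_le[OF J p] by (intro mult_left_mono) auto
      \<comment> \<open>Of the \<open>Suc m\<close> surplus factors \<open>s\<close> one is kept, the others pair with factors \<open>L\<close>.\<close>
      also have "\<dots> = (s * L) ^ m * (s * (L ^ length (ws ! p) * L * euclid_norm (vacuum ws)))"
        by (simp add: m power_add power_mult_distrib)
      also have "\<dots> \<le> 1 * (s * (L ^ N * L * euclid_norm (vacuum ws)))"
        using s L lens[OF p]
        by (intro mult_mono power_le_one mult_right_mono power_increasing mult_left_mono) auto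
      moreover have "ws ! p \<noteq> J" using False by auto
      ultimately show ?thesis by simp
    qed
    have "word_act n (\<lambda>i. complex_of_real s \<cdot>\<^sub>m fock_mat ws i) J (vacuum ws) \<bullet>c u - a J =
        (\<Sum>p<n. a (ws ! p) * (of_real s ^ length J / of_real s ^ length (ws ! p) * y J $ p - (if ws ! p = J then 1 else 0)))"
      unfolding form by (subst aJ) (simp add: right_diff_distrib sum_subtractf)
    also have "cmod \<dots> \<le> (\<Sum>p<n. cmod (a (ws ! p)) * (s * (L ^ N * L * euclid_norm (vacuum ws))))"
      by (rule order_trans[OF norm_sum], unfold norm_mult) (intro sum_mono mult_left_mono term_le, auto)
    also have "\<dots> = C * s"
      unfolding C_def sum_distrib_right by (intro sum.cong) (auto simp: mult_ac)
    finally show "cmod (word_act n (\<lambda>i. complex_of_real s \<cdot>\<^sub>m fock_mat ws i) J (vacuum ws) \<bullet>c u - a J) \<le> C * s" .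
  qed
  show thesis
  proof (rule that[of n "fock_mat ws" L C "vacuum ws"])
    show "mat_tuple d n (fock_mat ws)" unfolding n_def by (rule fock_tuple)
    show "norm_bounded n (fock_mat ws i) L" for i unfolding n_def L_def by (rule fock_bounded)
    show "0 \<le> C" using L by (auto simp: C_def intro!: mult_nonneg_nonneg sum_nonneg)
    show "vacuum ws \<in> carrier_vec n" by (simp add: n_def)
  qed (use fock_self_adjoint L appr in auto)
qed

section \<open>The two implications\<close>

lemma word_prod_cong:
  assumes "w \<in> words d" "\<And>i. i < d \<Longrightarrow> X i = Y i"
  shows "word_prod n X w = word_prod n Y w"
  using assms by (induction w) auto

lemma free_series_cong:
  assumes "\<And>i. i < d \<Longrightarrow> X i = Y i"
  shows "free_series d c n X = free_series d c n Y"
  unfolding free_series_def using word_prod_cong[of _ d X Y n] assms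
  by (intro eq_matI) (auto intro!: infsum_cong)

definition rank_one :: "nat \<Rightarrow> real \<Rightarrow> complex vec \<Rightarrow> complex mat" where
  "rank_one n t u = mat n n (\<lambda>(p, q). of_real t * u $ p * cnj (u $ q))"

lemma rank_one_carrier [simp]: "rank_one n t u \<in> carrier_mat n n"
  by (simp add: rank_one_def)

lemma rank_one_mult:
  assumes "u \<in> carrier_vec n" "x \<in> carrier_vec n"
  shows "rank_one n t u *\<^sub>v x = (of_real t * (x \<bullet>c u)) \<cdot>\<^sub>v u"
  using assms
  by (intro eq_vecI)
    (auto simp: rank_one_def scalar_prod_def row_def sum_distrib_left sum_distrib_right mult_ac intro!: sum.cong)

lemma rank_one_form:
  assumes "u \<in> carrier_vec n" "x \<in> carrier_vec n" "z \<in> carrier_vec n"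
  shows "(rank_one n t u *\<^sub>v x) \<bullet>c z = of_real t * ((x \<bullet>c u) * cnj (z \<bullet>c u))"
  using assms by (simp add: rank_one_mult cscalar_prod_cnj[of z n u])

lemma rank_one_psd:
  assumes "u \<in> carrier_vec n" "0 \<le> t"
  shows "psd_mat (rank_one n t u)"
proof -
  have "0 \<le> complex_of_real t * (z * cnj z)" for z
    using assms by (simp add: less_eq_complex_def)
  then show ?thesis
    using assms by (simp add: psd_mat_iff_form_nonneg[of _ n] rank_one_form)
qed

lemma rank_one_bounded:
  assumes u: "u \<in> carrier_vec n" and t: "0 \<le> t"
  shows "norm_bounded n (rank_one n t u) (t * (euclid_norm u)\<^sup>2)"
  unfolding norm_bounded_def
proof
  fix x :: "complex vec" assume x: "x \<in> carrier_vec n"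
  have "euclid_norm (rank_one n t u *\<^sub>v x) = t * cmod (x \<bullet>c u) * euclid_norm u"
    using u x t by (simp add: rank_one_mult euclid_norm_smult[of _ n] norm_mult)
  also have "\<dots> \<le> t * (euclid_norm x * euclid_norm u) * euclid_norm u"
    using cscalar_prod_norm_le[OF u x] t by (intro mult_right_mono mult_left_mono) auto
  finally show "euclid_norm (rank_one n t u *\<^sub>v x) \<le> t * (euclid_norm u)\<^sup>2 * euclid_norm x"
    by (simp add: power2_eq_square mult_ac)
qed

locale convergent_free_series =
  fixes d :: nat and \<epsilon> :: real and c :: "nat list \<Rightarrow> complex"
  assumes d: "1 \<le> d" and \<epsilon>: "0 < \<epsilon>"
    and conv: "\<And>n X. mat_tuple d n X \<Longrightarrow> tuple_norm d X \<le> real d + \<epsilon> \<Longrightarrow> series_converges d c n X"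
begin

text \<open>Convergence at the \<open>1 \<times> 1\<close> tuple with all entries equal to \<open>d + \<epsilon>\<close>; unordered convergence is absolute.\<close>

lemma coefficients_summable: "(\<lambda>w. cmod (c w) * (real d + \<epsilon>) ^ length w) summable_on words d"
proof -
  define r where "r = real d + \<epsilon>"
  have r: "0 \<le> r" using \<epsilon> by (simp add: r_def)
  define X where "X = (\<lambda>i::nat. complex_of_real r \<cdot>\<^sub>m (1\<^sub>m 1 :: complex mat))"
  have X: "mat_tuple d 1 X" by (simp add: mat_tuple_def X_def)
  have "norm_bounded 1 (1\<^sub>m 1) 1" by (simp add: norm_bounded_def)
  then have "norm_bounded 1 (X i) r" for i
    unfolding X_def using norm_bounded_smult[of "1\<^sub>m 1" 1 1 "complex_of_real r"] r by simp
  then have "tuple_norm d X \<le> r"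
    using op_norm_le[of _ 1] r X d by (simp add: tuple_norm_le_iff mat_tuple_def)
  then have "series_converges d c 1 X"
    using conv[OF X] by (simp add: r_def)
  moreover have "word_prod 1 X w = mat 1 1 (\<lambda>_. complex_of_real r ^ length w)" for w
    by (induction w) (auto simp: X_def scalar_prod_def intro!: eq_matI)
  ultimately have "(\<lambda>w. c w * complex_of_real r ^ length w) summable_on words d"
    by (simp add: series_converges_def)
  then have "(\<lambda>w. c w * complex_of_real r ^ length w) abs_summable_on words d"
    by (rule summable_on_iff_abs_summable_on_complex[THEN iffD1])
  then show ?thesis
    using r unfolding r_def[symmetric] by (simp add: norm_mult norm_power)
qed

lemma c_summable: "(\<lambda>w. cmod (c w)) summable_on words d"
proof (rule summable_on_comparison_test[OF coefficients_summable])
  show "cmod (c w) \<le> cmod (c w) * (real d + \<epsilon>) ^ length w" for w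
    using d \<epsilon> mult_left_mono[of 1 "(real d + \<epsilon>) ^ length w" "cmod (c w)"] by simp
qed auto

text \<open>As \<open>d + \<epsilon> > 1\<close>, Bernoulli's inequality lets the geometric weight absorb the length of the word.\<close>

lemma c_length_summable: "(\<lambda>w. real (length w) * cmod (c w)) summable_on words d"
proof (rule summable_on_comparison_test)
  define r where "r = real d + \<epsilon>"
  have r: "r > 1" using d \<epsilon> by (simp add: r_def)
  show "(\<lambda>w. cmod (c w) * r ^ length w * (1 / (r - 1))) summable_on words d"
    unfolding r_def by (intro summable_on_cmult_left coefficients_summable)
  show "real (length w) * cmod (c w) \<le> cmod (c w) * r ^ length w * (1 / (r - 1))" for w
  proof -
    have "1 + real (length w) * (r - 1) \<le> r ^ length w"
      using Bernoulli_inequality[of "r - 1" "length w"] r by simp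
    then have "real (length w) \<le> r ^ length w / (r - 1)"
      using r by (simp add: field_simps)
    then show ?thesis
      using mult_left_mono[of "real (length w)" "r ^ length w / (r - 1)" "cmod (c w)"] by (simp add: mult.commute)
  qed
qed auto

lemma ball_bounded:
  assumes "X \<in> self_adjoint_ball d (1 / real d) n" "i < d"
  shows "norm_bounded n (X i) 1"
proof (rule norm_bounded_mono[OF norm_bounded_op_norm])
  show "X i \<in> carrier_mat n n" using assms by (simp add: self_adjoint_ball_def mat_tuple_def)
  have "op_norm (X i) \<le> 1 / real d"
    using assms d by (simp add: self_adjoint_ball_def tuple_norm_le_iff)
  also have "\<dots> \<le> 1" using d by simp
  finally show "op_norm (X i) \<le> 1" .
qed

lemma ball_converges:
  assumes "X \<in> self_adjoint_ball d (1 / real d) n"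
  shows "series_converges d c n X"
proof (rule conv)
  have "tuple_norm d X \<le> 1 / real d" using assms by (simp add: self_adjoint_ball_def)
  also have "\<dots> \<le> 1" using d by simp
  also have "\<dots> \<le> real d + \<epsilon>" using d \<epsilon> by linarith
  finally show "tuple_norm d X \<le> real d + \<epsilon>" .
qed (use assms in \<open>simp add: self_adjoint_ball_def\<close>)

lemma self_adjoint_ballI:
  assumes "mat_tuple d n X" "\<And>i. i < d \<Longrightarrow> self_adjoint (X i)"
    and "\<And>i. i < d \<Longrightarrow> norm_bounded n (X i) (1 / real d)"
  shows "X \<in> self_adjoint_ball d (1 / real d) n"
  using assms d op_norm_le[of _ n "1 / real d"]
  by (auto simp: self_adjoint_ball_def tuple_norm_le_iff mat_tuple_def)

lemma form_eq_infsum: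
  assumes "X \<in> self_adjoint_ball d (1 / real d) n" "v \<in> carrier_vec n"
  shows "(free_series d c n X *\<^sub>v v) \<bullet>c v = (\<Sum>\<^sub>\<infinity>w\<in>words d. c w * (word_act n X w v \<bullet>c v))"
  using free_series_form[OF _ ball_converges[OF assms(1)] assms(2) assms(2)] assms
  by (intro infsumI[symmetric]) (simp add: self_adjoint_ball_def)

lemma monotone_if_psd:
  assumes psd: "\<And>k. k < d \<Longrightarrow> infinite_psd (words d) (\<lambda>I J. c (rev I @ k # J))"
  shows "matrix_monotone_on d (self_adjoint_ball d (1 / real d)) (free_series d c)"
  unfolding matrix_monotone_on_def
proof (intro allI ballI impI)
  fix n X Y
  assume ball_X: "X \<in> self_adjoint_ball d (1 / real d) n" and ball_Y: "Y \<in> self_adjoint_ball d (1 / real d) n"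
    and le: "tuple_le d X Y"
  interpret convergent_segment d n X Y c
    using ball_X ball_Y d c_summable c_length_summable ball_bounded
    by unfold_locales (auto simp: self_adjoint_ball_def)
  have seg_ball: "seg 0 \<in> self_adjoint_ball d (1 / real d) n" "seg 1 \<in> self_adjoint_ball d (1 / real d) n"
    using ball_X ball_Y d seg_0 seg_1 seg_tuple by (auto simp: self_adjoint_ball_def tuple_norm_le_iff)
  have F: "free_series d c n Z \<in> carrier_mat n n" for Z by (simp add: free_series_def)
  have "mat_le (free_series d c n (seg 0)) (free_series d c n (seg 1))"
    unfolding mat_le_iff_form_le[OF F F]
    using series_form_increasing[OF psd le] by (simp add: form_eq_infsum seg_ball)
  then show "mat_le (free_series d c n X) (free_series d c n Y)"
    using free_series_cong[of d "seg 0" X] free_series_cong[of d "seg 1" Y] seg_0 seg_1 by simp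
qed

text \<open>Increase the tuple \<open>Z\<close> in the coordinate \<open>k\<close> only, by a multiple of \<open>u u\<^sup>*\<close> small enough to stay in the ball.
  Monotonicity makes the derivative at \<open>Z\<close> nonnegative, and for a rank-one increment the Gram kernel is itself
  of rank one.\<close>

lemma monotone_rank_one_sum_nonneg:
  assumes mono: "matrix_monotone_on d (self_adjoint_ball d (1 / real d)) (free_series d c)"
    and k: "k < d" and Z: "mat_tuple d n Z" "\<And>i. i < d \<Longrightarrow> self_adjoint (Z i)"
      "\<And>i. i < d \<Longrightarrow> norm_bounded n (Z i) (1 / (2 * real d))"
    and e: "e \<in> carrier_vec n" and u: "u \<in> carrier_vec n"
  shows "0 \<le> (\<Sum>\<^sub>\<infinity>(I, J)\<in>words d \<times> words d.
    c (rev I @ k # J) * ((word_act n Z J e \<bullet>c u) * cnj (word_act n Z I e \<bullet>c u)))" (is "0 \<le> ?T")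
proof -
  \<comment> \<open>Half of the radius is left for the increment; the \<open>1 +\<close> covers the case \<open>u = 0\<close>.\<close>
  define \<tau> where "\<tau> = 1 / (2 * real d * (1 + (euclid_norm u)\<^sup>2))"
  have pos: "1 + (euclid_norm u)\<^sup>2 > 0" by (simp add: add_pos_nonneg)
  have \<tau>: "\<tau> > 0" "\<tau> * (euclid_norm u)\<^sup>2 \<le> 1 / (2 * real d)"
  proof -
    show "\<tau> > 0" unfolding \<tau>_def using d pos by (intro divide_pos_pos mult_pos_pos) auto
    have "\<tau> * (euclid_norm u)\<^sup>2 = 1 / (2 * real d) * ((euclid_norm u)\<^sup>2 / (1 + (euclid_norm u)\<^sup>2))"
      by (simp add: \<tau>_def)
    also have "\<dots> \<le> 1 / (2 * real d) * 1"
      using pos by (intro mult_left_mono) (auto simp: divide_le_eq_1)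
    finally show "\<tau> * (euclid_norm u)\<^sup>2 \<le> 1 / (2 * real d)" by simp
  qed
  define R where "R = rank_one n \<tau> u"
  have R: "R \<in> carrier_mat n n" "psd_mat R" "norm_bounded n R (1 / (2 * real d))"
    using u \<tau> rank_one_psd[OF u] norm_bounded_mono[OF rank_one_bounded[OF u, of \<tau>]] by (auto simp: R_def)
  define Y where "Y = (\<lambda>i. if i = k then Z i + R else Z i)"
  have Zc: "Z i \<in> carrier_mat n n" if "i < d" for i
    using Z(1) that by (simp add: mat_tuple_def)
  have Yc: "mat_tuple d n Y" using Zc R by (simp add: mat_tuple_def Y_def)
  have Ysa: "self_adjoint (Y i)" if "i < d" for i
    using Z(2) Zc that R by (auto simp: Y_def psd_mat_def intro: self_adjoint_add[of _ n])
  have half: "1 / (2 * real d) + 1 / (2 * real d) = 1 / real d" by simp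
  have h1: "1 / (2 * real d) \<le> 1 / real d" "1 / real d \<le> 1" using d by (auto simp: field_simps)
  have Yb: "norm_bounded n (Y i) (1 / real d)" if "i < d" for i
    using norm_bounded_add[OF Zc[OF that] R(1) Z(3)[OF that] R(3)] norm_bounded_mono[OF Z(3)[OF that] h1(1)]
    by (auto simp: Y_def)
  interpret convergent_segment d n Z Y c
    using Z Yc Ysa norm_bounded_mono[OF Yb h1(2)] norm_bounded_mono[OF Z(3) order_trans[OF h1]]
      d c_summable c_length_summable by unfold_locales auto
  have diff: "Y i - Z i = (if i = k then R else 0\<^sub>m n n)" if "i < d" for i
    using Zc[OF that] R(1) by (auto simp: Y_def intro!: eq_matI)
  have zero_act: "0\<^sub>m n n *\<^sub>v x = 0\<^sub>v n" if "x \<in> carrier_vec n" for x :: "complex vec"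
    using that by (intro eq_vecI) auto
  have zero_bounded: "norm_bounded n (0\<^sub>m n n) (1 / (2 * real d))"
    by (simp add: norm_bounded_def zero_act)
  have seg_ball: "seg t \<in> self_adjoint_ball d (1 / real d) n" if t: "t \<in> {0..1}" for t
  proof (rule self_adjoint_ballI[OF seg_tuple seg_self_adjoint])
    fix i assume i: "i < d"
    have "norm_bounded n (Y i - Z i) (1 / (2 * real d))"
      using R(3) zero_bounded by (simp add: diff[OF i])
    then have "norm_bounded n (seg t i) (1 / (2 * real d) + cmod (complex_of_real t) * (1 / (2 * real d)))"
      unfolding seg_def using i Z(3) Zc diff_carrier by (intro norm_bounded_add norm_bounded_smult) auto
    then show "norm_bounded n (seg t i) (1 / real d)"
      using t mult_right_mono[of t 1 "1 / (2 * real d)"] half by (elim norm_bounded_mono) auto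
  qed
  have seg_le: "tuple_le d (seg 0) (seg t)" if t: "t \<in> {0..1}" for t
    unfolding tuple_le_def
  proof (intro allI impI)
    fix i assume i: "i < d"
    have sc: "seg s i \<in> carrier_mat n n" for s using seg_tuple i by (simp add: mat_tuple_def)
    have "(seg t i *\<^sub>v v) \<bullet>c v = (seg 0 i *\<^sub>v v) \<bullet>c v + of_real t * (((Y i - Z i) *\<^sub>v v) \<bullet>c v)"
      if v: "v \<in> carrier_vec n" for v
      using v Zc[OF i] diff_carrier[OF i]
      by (simp add: seg_0[OF i]) (simp add: seg_def add_mult_distrib_mat_vec[of _ n n] smult_mult_mat_vec[of _ n n]
          cscalar_prod_add_left[of _ n])
    moreover have "0 \<le> complex_of_real t * (((Y i - Z i) *\<^sub>v v) \<bullet>c v)" if v: "v \<in> carrier_vec n" for v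
    proof -
      have "0 \<le> ((Y i - Z i) *\<^sub>v v) \<bullet>c v"
        using v R psd_mat_iff_form_nonneg[of R n] by (simp add: diff[OF i] zero_act)
      then show ?thesis using t by (simp add: less_eq_complex_def)
    qed
    ultimately show "mat_le (seg 0 i) (seg t i)"
      unfolding mat_le_iff_form_le[OF sc sc] by simp
  qed
  have F: "free_series d c n Z \<in> carrier_mat n n" for Z by (simp add: free_series_def)
  have incr: "(\<Sum>\<^sub>\<infinity>w\<in>words d. c w * (word_act n (seg 0) w e \<bullet>c e)) \<le>
      (\<Sum>\<^sub>\<infinity>w\<in>words d. c w * (word_act n (seg t) w e \<bullet>c e))" if t: "t \<in> {0..1}" for t
  proof -
    have 0: "seg 0 \<in> self_adjoint_ball d (1 / real d) n" by (rule seg_ball) simp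
    have "mat_le (free_series d c n (seg 0)) (free_series d c n (seg t))"
      using mono 0 seg_ball[OF t] seg_le[OF t] unfolding matrix_monotone_on_def by blast
    then show ?thesis
      unfolding mat_le_iff_form_le[OF F F] using e by (simp add: form_eq_infsum 0 seg_ball[OF t])
  qed
  have act: "word_act n (seg 0) w e = word_act n Z w e" if "w \<in> words d" for w
    unfolding word_act_def using word_prod_cong[OF that, of "seg 0" Z n] seg_0 by simp
  have "0 \<le> (\<Sum>i<d. \<Sum>\<^sub>\<infinity>(I, J)\<in>words d \<times> words d. deriv_term i 0 e I J)"
    by (rule derivative_nonneg_at_0[OF e incr])
  also have "\<dots> = (\<Sum>i<d. if i = k then complex_of_real \<tau> * ?T else 0)"
  proof (rule sum.cong[OF refl])
    fix i assume i: "i \<in> {..<d}"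
    have deriv_term: "deriv_term i 0 e I J = (if i = k then complex_of_real \<tau> *
        (c (rev I @ k # J) * ((word_act n Z J e \<bullet>c u) * cnj (word_act n Z I e \<bullet>c u))) else 0)"
      if "I \<in> words d" "J \<in> words d" for I J
      using that i e u diff[of i] word_act_carrier[OF Z(1)] by (auto simp: act R_def rank_one_form zero_act)
    show "(\<Sum>\<^sub>\<infinity>(I, J)\<in>words d \<times> words d. deriv_term i 0 e I J) = (if i = k then complex_of_real \<tau> * ?T else 0)"
    proof (cases "i = k")
      case True
      have "(\<Sum>\<^sub>\<infinity>(I, J)\<in>words d \<times> words d. deriv_term i 0 e I J) = (\<Sum>\<^sub>\<infinity>x\<in>words d \<times> words d. complex_of_real \<tau> *
          (case x of (I, J) \<Rightarrow> c (rev I @ k # J) * ((word_act n Z J e \<bullet>c u) * cnj (word_act n Z I e \<bullet>c u))))"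
        using deriv_term True by (intro infsum_cong) auto
      then show ?thesis using True by (simp add: infsum_cmult_right')
    next
      case False
      then show ?thesis using deriv_term by (auto intro!: infsum_0)
    qed
  qed
  also have "\<dots> = complex_of_real \<tau> * ?T"
    using k by simp
  finally show ?thesis
    using \<tau>(1) by (simp add: less_eq_complex_def zero_le_mult_iff)
qed

text \<open>The rank-one sums for the Fock tuples \<open>s A\<close> tend, as \<open>s\<close> tends to \<open>0\<close>, to the form of the kernel at the
  prescribed vector: the interpolation error is uniform in the words and the coefficients are absolutely
  summable.\<close>

lemma psd_if_monotone:
  assumes mono: "matrix_monotone_on d (self_adjoint_ball d (1 / real d)) (free_series d c)"
    and k: "k < d"
  shows "infinite_psd (words d) (\<lambda>I J. c (rev I @ k # J))"
  unfolding infinite_psd_iff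
proof (intro allI impI)
  fix F assume F: "finite F \<and> F \<subseteq> words d"
  show "psd_kernel F (\<lambda>I J. c (rev I @ k # J))"
    unfolding psd_kernel_def
  proof
    fix b :: "nat list \<Rightarrow> complex"
    define a where "a = (\<lambda>w. if w \<in> F then b w else 0)"
    obtain n A e L C where A: "mat_tuple d n A" "\<And>i. i < d \<Longrightarrow> self_adjoint (A i)"
        "\<And>i. i < d \<Longrightarrow> norm_bounded n (A i) L" and L: "1 \<le> L" and C: "0 \<le> C" and e: "e \<in> carrier_vec n"
      and appr: "\<And>s. 0 < s \<Longrightarrow> s * L \<le> 1 \<Longrightarrow> \<exists>u\<in>carrier_vec n. \<forall>J\<in>words d.
         cmod (word_act n (\<lambda>i. complex_of_real s \<cdot>\<^sub>m A i) J e \<bullet>c u - a J) \<le> C * s"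
      by (rule fock_interpolation[OF conjunct1[OF F] conjunct2[OF F], of a])
        (simp add: a_def, rule that, assumption+)
    define B where "B = (\<Sum>w\<in>F. cmod (a w))"
    have B: "cmod (a w) \<le> B" for w
      using F member_le_sum[of w F "\<lambda>w. cmod (a w)"] sum_nonneg[of F "\<lambda>w. cmod (a w)"]
      by (cases "w \<in> F") (auto simp: B_def a_def)
    have B0: "0 \<le> B" using B[of "[]"] norm_ge_zero order_trans by blast
    let ?c = "\<lambda>I J. c (rev I @ k # J)" and ?W = "words d \<times> words d"
    have c_sum: "(\<lambda>(I, J). cmod (?c I J)) summable_on ?W"
      using summable_on_split_words[of d "\<lambda>w. cmod (c w)", OF _ c_length_summable k] by simp
    define T where "T = (\<Sum>\<^sub>\<infinity>(I, J)\<in>?W. ?c I J * (a J * cnj (a I)))"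
    define M where "M = (\<Sum>\<^sub>\<infinity>(I, J)\<in>?W. cmod (?c I J))"
    define K where "K = C * (2 * B + C)"
    have summ: "(\<lambda>(I, J). ?c I J * (y J * cnj (y I))) summable_on ?W"
      if "\<And>J. J \<in> words d \<Longrightarrow> cmod (y J) \<le> D" for y and D :: real
    proof (rule abs_summable_summable, rule summable_on_comparison_test)
      show "(\<lambda>x. (case x of (I, J) \<Rightarrow> cmod (?c I J)) * (D * D)) summable_on ?W"
        by (intro summable_on_cmult_left c_sum)
      show "cmod (case x of (I, J) \<Rightarrow> ?c I J * (y J * cnj (y I))) \<le> (case x of (I, J) \<Rightarrow> cmod (?c I J)) * (D * D)"
        if "x \<in> ?W" for x
        using that \<open>\<And>J. J \<in> words d \<Longrightarrow> cmod (y J) \<le> D\<close> order_trans[OF norm_ge_zero \<open>\<And>J. J \<in> words d \<Longrightarrow> cmod (y J) \<le> D\<close>]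
        by (auto simp: norm_mult intro!: mult_left_mono mult_mono)
    qed auto
    have step: "\<exists>T'. 0 \<le> T' \<and> cmod (T' - T) \<le> M * K * s" if s: "0 < s" "s * L \<le> 1 / (2 * real d)" for s
    proof -
      have s1: "s \<le> 1" "s * L \<le> 1"
      proof -
        have "1 / (2 * real d) \<le> 1" using d by (simp add: field_simps)
        with s show sL: "s * L \<le> 1" by linarith
        have "s * 1 \<le> s * L" using s L by (intro mult_left_mono) auto
        with sL show "s \<le> 1" by linarith
      qed
      obtain u where u: "u \<in> carrier_vec n" and
        close: "\<And>J. J \<in> words d \<Longrightarrow> cmod (word_act n (\<lambda>i. complex_of_real s \<cdot>\<^sub>m A i) J e \<bullet>c u - a J) \<le> C * s"
        using appr[OF s(1) s1(2)] by blast
      define Z where "Z = (\<lambda>i. complex_of_real s \<cdot>\<^sub>m A i)"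
      define y where "y = (\<lambda>J. word_act n Z J e \<bullet>c u)"
      have y: "cmod (y J - a J) \<le> C * s" if "J \<in> words d" for J
        using close[OF that] by (simp add: y_def Z_def)
      have Cs: "C * s \<le> C" using C s1 mult_left_mono[of s 1 C] by simp
      have y_le: "cmod (y J) \<le> B + C" if "J \<in> words d" for J
        using y[OF that] B[of J] Cs norm_triangle_sub[of "y J" "a J"] by linarith
      define T' where "T' = (\<Sum>\<^sub>\<infinity>(I, J)\<in>?W. ?c I J * (y J * cnj (y I)))"
      have "0 \<le> T'"
        unfolding T'_def y_def
      proof (rule monotone_rank_one_sum_nonneg[OF mono k _ _ _ e u])
        show "mat_tuple d n Z" using A(1) by (simp add: mat_tuple_def Z_def)
        show "self_adjoint (Z i)" if "i < d" for i
          using A that by (auto simp: Z_def mat_tuple_def intro: self_adjoint_smult[of _ n])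
        show "norm_bounded n (Z i) (1 / (2 * real d))" if "i < d" for i
          using norm_bounded_mono[OF norm_bounded_smult[of "A i" n L "complex_of_real s"]] A that s
          by (auto simp: Z_def mat_tuple_def)
      qed
      moreover have "cmod (T' - T) \<le> M * K * s"
      proof -
        have diff: "((\<lambda>(I, J). ?c I J * (y J * cnj (y I) - a J * cnj (a I))) has_sum (T' - T)) ?W"
          using has_sum_add[OF has_sum_infsum[OF summ[of y, OF y_le]] has_sum_uminusI[OF has_sum_infsum[OF summ[of a, OF B]]]]
          by (simp add: case_prod_unfold right_diff_distrib T'_def T_def)
        have "cmod (T' - T) \<le> (\<Sum>\<^sub>\<infinity>x\<in>?W. (case x of (I, J) \<Rightarrow> cmod (?c I J)) * (K * s))"
        proof (rule norm_infsum_le[OF diff])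
          show "((\<lambda>x. (case x of (I, J) \<Rightarrow> cmod (?c I J)) * (K * s)) has_sum
              (\<Sum>\<^sub>\<infinity>x\<in>?W. (case x of (I, J) \<Rightarrow> cmod (?c I J)) * (K * s))) ?W"
            by (intro has_sum_infsum summable_on_cmult_left c_sum)
          show "cmod (case x of (I, J) \<Rightarrow> ?c I J * (y J * cnj (y I) - a J * cnj (a I)))
              \<le> (case x of (I, J) \<Rightarrow> cmod (?c I J)) * (K * s)" if x: "x \<in> ?W" for x
          proof -
            obtain I J where x': "x = (I, J)" "I \<in> words d" "J \<in> words d" using x by auto
            have "y J * cnj (y I) - a J * cnj (a I) = (y J - a J) * cnj (y I) + a J * cnj (y I - a I)"
              by (simp add: algebra_simps)
            also have "cmod \<dots> \<le> cmod (y J - a J) * cmod (y I) + cmod (a J) * cmod (y I - a I)"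
              by (rule order_trans[OF norm_triangle_ineq]) (simp add: norm_mult flip: complex_cnj_diff)
            also have "\<dots> \<le> (C * s) * (B + C) + B * (C * s)"
              using x' y y_le B B0 C s by (intro add_mono mult_mono) auto
            also have "\<dots> = K * s" by (simp add: K_def algebra_simps)
            finally show ?thesis using x' by (simp add: norm_mult mult_left_mono)
          qed
        qed
        also have "\<dots> = M * (K * s)" unfolding M_def by (rule infsum_cmult_left')
        finally show ?thesis by (simp add: mult.assoc)
      qed
      ultimately show ?thesis by blast
    qed
    \<comment> \<open>Scales that keep the tuple \<open>\<sigma> m A\<close> within half of the radius \<open>1 / d\<close>.\<close>
    define \<sigma> where "\<sigma> = (\<lambda>m::nat. 1 / (2 * real d * L) * inverse (real (Suc m)))"
    have \<sigma>: "0 < \<sigma> m" "\<sigma> m * L \<le> 1 / (2 * real d)" for m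
    proof -
      show "0 < \<sigma> m"
        unfolding \<sigma>_def using d L by (intro mult_pos_pos divide_pos_pos) auto
      have "inverse (real (Suc m)) \<le> 1" by (simp add: inverse_le_1_iff)
      then have "1 / (2 * real d) * inverse (real (Suc m)) \<le> 1 / (2 * real d) * 1"
        by (intro mult_left_mono) auto
      moreover have "\<sigma> m * L = 1 / (2 * real d) * inverse (real (Suc m))"
        using L by (simp add: \<sigma>_def)
      ultimately show "\<sigma> m * L \<le> 1 / (2 * real d)" by simp
    qed
    have "\<forall>m. \<exists>T'. 0 \<le> T' \<and> cmod (T' - T) \<le> M * K * \<sigma> m"
      using step \<sigma> by blast
    then obtain T' where T': "\<And>m. 0 \<le> T' m" "\<And>m. cmod (T' m - T) \<le> M * K * \<sigma> m"
      by metis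
    have "(\<lambda>m. 1 / (2 * real d * L) * inverse (real (Suc m))) \<longlonglongrightarrow> 1 / (2 * real d * L) * 0"
      by (rule tendsto_mult[OF tendsto_const LIMSEQ_inverse_real_of_nat])
    then have "\<sigma> \<longlonglongrightarrow> 0"
      unfolding \<sigma>_def by simp
    then have "(\<lambda>m. M * K * \<sigma> m) \<longlonglongrightarrow> 0"
      by (rule tendsto_mult_right_zero)
    then have "(\<lambda>m. T' m - T) \<longlonglongrightarrow> 0"
      by (rule Lim_null_comparison[OF always_eventually[OF allI[OF T'(2)]]])
    then have "T' \<longlonglongrightarrow> T" by (simp add: LIM_zero_iff)
    then have "T \<in> {z. 0 \<le> z}"
      using T'(1) by (elim closed_sequentially[OF closed_complex_nonneg, rotated]) simp
    moreover have "T = (\<Sum>I\<in>F. \<Sum>J\<in>F. ?c I J * b J * cnj (b I))"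
    proof -
      have "T = (\<Sum>\<^sub>\<infinity>(I, J)\<in>F \<times> F. ?c I J * (a J * cnj (a I)))"
        unfolding T_def using F by (intro infsum_cong_neutral) (auto simp: a_def split: if_splits)
      also have "\<dots> = (\<Sum>I\<in>F. \<Sum>J\<in>F. ?c I J * b J * cnj (b I))"
        using F by (simp add: sum.cartesian_product[symmetric] a_def mult.assoc cong: sum.cong)
      finally show ?thesis .
    qed
    ultimately show "0 \<le> (\<Sum>I\<in>F. \<Sum>J\<in>F. ?c I J * b J * cnj (b I))" by simp
  qed
qed

end

theorem theorem1p9:
  fixes d :: nat and \<epsilon> :: real and c :: "nat list \<Rightarrow> complex"
  assumes "1 \<le> d" and "0 < \<epsilon>"
    and "\<And>n X. mat_tuple d n X \<Longrightarrow> tuple_norm d X \<le> real d + \<epsilon> \<Longrightarrow> series_converges d c n X"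
  shows "matrix_monotone_on d (self_adjoint_ball d (1 / real d)) (free_series d c)
    \<longleftrightarrow> (\<forall>k<d. infinite_psd (words d) (\<lambda>I J. c (rev I @ k # J)))"
proof -
  interpret convergent_free_series d \<epsilon> c
    using assms by unfold_locales
  show ?thesis
    using monotone_if_psd psd_if_monotone by blast
qed

end
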